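(* Let $R>0$, let $\rho$ be a correlation coefficient with $|\rho|<1$, and set $a=\frac{R}{\sqrt{1-|\rho|}}$, $b=\frac{R}{\sqrt{1+|\rho|}}$ and $q=\sqrt{\frac{a-b}{a+b}}$. Consider the following Dirichlet problem for a function $f(r,\theta)$, where $q\le r\le 1$, $0\le\theta\le 2\pi$, $f$ is $2\pi$-periodic in $\theta$, and $h$ is the boundary datum: $$\begin{cases}\dfrac{\partial^2 f}{\partial r^2}+\dfrac1r\dfrac{\partial f}{\partial r}+\dfrac1{r^2}\dfrac{\partial^2 f}{\partial\theta^2}=0, & r<1,\\[2mm] f(r,\theta)=h(\theta), & r=1,\\[1mm] f(q,\theta)\ \text{is even in }\theta,\ \text{i.e. } f(q,\theta)=f(q,-\theta),\\[1mm] \dfrac{\partial}{\partial r}f(r,\theta)\Big|_{r=q}\ \text{is odd in }\theta,\ \text{i.e. } \dfrac{\partial}{\partial r}f(r,\theta)\Big|_{r=q}=-\dfrac{\partial}{\partial r}f(r,-\theta)\Big|_{r=q}.\end{cases}$$ The general solution of this Dirichlet problem is $$f(r,\theta)=\int_0^{2\pi}h(\tau)\left[\frac1{2\pi}+\frac1\pi\sum_{k=1}^{+\infty}r^k\left(\frac{1+\left(\frac qr\right)^{2k}}{1+q^{2k}}\cos k\theta\cos k\tau+\frac{1-\left(\frac qr\right)^{2k}}{1-q^{2k}}\sin k\theta\sin k\tau\right)\right]d\tau .$$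
   Context: The problem arises from the Dirichlet problem $\frac{\partial^2u}{\partial w^2}+\frac{\partial^2u}{\partial z^2}=0$ in the ellipse $E=\{(w,z): w^2(1-|\rho|)+z^2(1+|\rho|)<R^2\}$, which has semiaxes $a$ and $b$, with prescribed values $h$ on $\partial E$. One sets $f(r,\theta)=u(w,z)$ with $w=\left(\frac{a+b}{2}r+\frac{a-b}{2}\frac1r\right)\cos\theta$ and $z=\left(\frac{a+b}{2}r-\frac{a-b}{2}\frac1r\right)\sin\theta$, for $0\le\theta\le2\pi$ and $q\le r\le1$. The circle $r=1$ corresponds to $\partial E$ and the circle $r=q$ to the segment joining the foci of $E$, with $(q,\theta)$ and $(q,-\theta)$ giving the same point of that segment. The even and odd conditions at $r=q$ express the matching of $u$ and of its slope across this segment.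
   Formalization: h and f are taken continuous (f up to r=1); the formula is asserted for r<1 only, as the series diverges at r=1, with f=h there; for ρ=0 (q=0) the oddness condition and the equation at r=0 are dropped, since h=cos θ gives f=r cos θ, whose r-derivative at 0 is not odd. *)

theory Defs
  imports "HOL-Analysis.Analysis"
begin

(* The function f is written as f r \<theta>; only its values for q \<le> r \<le> 1 matter.
   The angle ranges over all reals, with 2 pi-periodicity imposed.  The derivatives in r
   are taken within {q..1}: they are the ordinary ones for q < r < 1 and one-sided at r = q.
   The equation is required for q \<le> r < 1, except at r = 0 (possible only if q = 0),
   where its coefficients are undefined.
   If q = 0 (equal semiaxes), the focal segment is a single point, there is no slit across
   which slopes could be matched, and the oddness condition is void.  Imposed literally at
   r = 0 it would fail already for the regular solution r * cos \<theta> with boundary datum cos. *)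
definition slit_dirichlet_solution ::
    "real \<Rightarrow> (real \<Rightarrow> real) \<Rightarrow> (real \<Rightarrow> real \<Rightarrow> real) \<Rightarrow> bool" where
  "slit_dirichlet_solution q h f \<longleftrightarrow>
     continuous_on ({q..1} \<times> UNIV) (\<lambda>(r, \<theta>). f r \<theta>) \<and>
     (\<forall>r\<in>{q..1}. \<forall>\<theta>. f r (\<theta> + 2 * pi) = f r \<theta>) \<and>
     (\<exists>fr frr ft ftt :: real \<Rightarrow> real \<Rightarrow> real.
        (\<forall>r\<in>{q..<1}. \<forall>\<theta>. 0 < r \<longrightarrow>
           ((\<lambda>s. f s \<theta>) has_real_derivative fr r \<theta>) (at r within {q..1}) \<and>
           ((\<lambda>s. fr s \<theta>) has_real_derivative frr r \<theta>) (at r within {q..1}) \<and>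
           ((\<lambda>t. f r t) has_real_derivative ft r \<theta>) (at \<theta>) \<and>
           ((\<lambda>t. ft r t) has_real_derivative ftt r \<theta>) (at \<theta>) \<and>
           frr r \<theta> + 1 / r * fr r \<theta> + 1 / r\<^sup>2 * ftt r \<theta> = 0) \<and>
        (0 < q \<longrightarrow> (\<forall>\<theta>. fr q \<theta> = - fr q (- \<theta>)))) \<and>
     (\<forall>\<theta>. f 1 \<theta> = h \<theta>) \<and>
     (\<forall>\<theta>. f q \<theta> = f q (- \<theta>))"

definition slit_kernel_term :: "real \<Rightarrow> real \<Rightarrow> real \<Rightarrow> real \<Rightarrow> nat \<Rightarrow> real" where
  "slit_kernel_term q r \<theta> \<tau> k =
     r ^ k * ((1 + (q / r) ^ (2 * k)) / (1 + q ^ (2 * k)) * cos (k * \<theta>) * cos (k * \<tau>)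
            + (1 - (q / r) ^ (2 * k)) / (1 - q ^ (2 * k)) * sin (k * \<theta>) * sin (k * \<tau>))"

(* Terms start at k = 1, hence the shift by Suc. *)
definition slit_kernel :: "real \<Rightarrow> real \<Rightarrow> real \<Rightarrow> real \<Rightarrow> real" where
  "slit_kernel q r \<theta> \<tau> =
     1 / (2 * pi) + 1 / pi * (\<Sum>k. slit_kernel_term q r \<theta> \<tau> (Suc k))"

end

theory Submission
  imports Defs "HOL-Complex_Analysis.Cauchy_Integral_Formula"
begin

text \<open>
  Write \<open>z = r e\<^sup>i\<^sup>\<theta>\<close> and let \<open>A\<^sub>k\<close>, \<open>B\<^sub>k\<close> be the integrals of
  \<open>h cos k\<tau>\<close> and \<open>h sin k\<tau>\<close> over a period. The \<open>k\<close>-th term of the kernel, integrated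
  against \<open>h\<close>, is the real part of \<open>\<alpha>\<^sub>k (z\<^sup>k + (q\<^sup>2/z)\<^sup>k)\<close> with
  \<open>\<alpha>\<^sub>k = A\<^sub>k/(1 + q\<^sup>2\<^sup>k) - \<i> B\<^sub>k/(1 - q\<^sup>2\<^sup>k)\<close>. So, with the power series
  \<open>S(z) = \<Sum> \<alpha>\<^sub>k z\<^sup>k\<close>, the integral formula is, up to a factor \<open>1/\<pi>\<close> and an additive
  constant, the real part of \<open>\<Phi>(z) = S(z) + S(q\<^sup>2/z)\<close> (\<open>slit_integral_eq_series\<close>).
  The function \<open>\<Phi>\<close> is holomorphic on the annulus \<open>q\<^sup>2 < |z| < 1\<close>, which contains the
  circle \<open>|z| = q\<close> in its interior if \<open>q > 0\<close>; hence its real part satisfies the polar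
  Laplace equation up to that circle. Moreover \<open>\<Phi>\<close> is invariant under \<open>z \<mapsto> q\<^sup>2/z\<close>, which on
  \<open>|z| = q\<close> is complex conjugation. This one symmetry gives both matching conditions: the
  values at \<open>r = q\<close> are even in \<open>\<theta>\<close> and the slopes are odd
  (\<open>slit_potential_solution_if_continuous\<close>).

  Uniqueness follows from a maximum principle (\<open>slit_maximum_principle\<close>). Adding a small
  multiple of \<open>ln r + r\<^sup>2\<close> to a solution makes it strictly subharmonic, which excludes interior
  maxima. A maximum at \<open>(q, \<theta>)\<close> would by evenness also be one at \<open>(q, -\<theta>)\<close>, so both radial
  slopes would be at most \<open>0\<close> there; but by oddness they add up to a positive number coming
  from the added term. If \<open>q = 0\<close>, the logarithm keeps the maximum away from the origin.

  The attainment of the boundary values is reduced to finitely many modes. For a trigonometric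
  polynomial \<open>h\<close> the orthogonality relations turn the integral into an explicit finite sum
  that is continuous up to \<open>r = 1\<close>, so it is a solution. For continuous periodic \<open>h\<close>,
  trigonometric polynomials converge to \<open>h\<close> uniformly (\<open>trig_poly_dense\<close>); by the maximum
  principle the potentials of these polynomials converge uniformly as well, and the limit is
  the potential of \<open>h\<close> (\<open>slit_potential_trig_poly_approx\<close>), which is therefore continuous on
  the closed region.
\<close>

section \<open>Trigonometric polynomials\<close>

inductive trig_poly :: "(real \<Rightarrow> real) \<Rightarrow> bool" where
  cos: "trig_poly (\<lambda>t. cos (real m * t))"
| sin: "trig_poly (\<lambda>t. sin (real m * t))"
| add: "trig_poly g \<Longrightarrow> trig_poly h \<Longrightarrow> trig_poly (\<lambda>t. g t + h t)"
| scale: "trig_poly g \<Longrightarrow> trig_poly (\<lambda>t. c * g t)"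

lemma trig_poly_diff:
  assumes "trig_poly g" "trig_poly h"
  shows "trig_poly (\<lambda>t. g t - h t)"
  using trig_poly.add[OF assms(1) trig_poly.scale[OF assms(2), of "-1"]] by simp

lemma trig_poly_const: "trig_poly (\<lambda>t. c)"
  using trig_poly.scale[OF trig_poly.cos[of 0], of c] by simp

text \<open>
  Integer frequencies absorb the sign of \<open>m - n\<close> in the product-to-sum formulas
  below.
\<close>

lemma trig_poly_cos_int: "trig_poly (\<lambda>t. cos (of_int k * t))"
proof (cases k rule: int_cases2)
  case (nonneg n) then show ?thesis using trig_poly.cos[of n] by simp
next
  case (nonpos n) then show ?thesis using trig_poly.cos[of n] by simp
qed

lemma trig_poly_sin_int: "trig_poly (\<lambda>t. sin (of_int k * t))"
proof (cases k rule: int_cases2)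
  case (nonneg n) then show ?thesis using trig_poly.sin[of n] by simp
next
  case (nonpos n) then show ?thesis using trig_poly.scale[OF trig_poly.sin[of n], of "-1"] by simp
qed

lemma trig_poly_mult:
  assumes "trig_poly g" "trig_poly h"
  shows "trig_poly (\<lambda>t. g t * h t)"
  using assms(1)
proof induction
  case (cos m)
  show ?case using assms(2)
  proof induction
    case (cos n)
    show ?case
      using trig_poly.scale[OF trig_poly.add[OF trig_poly_cos_int[of "int m - int n"] trig_poly_cos_int[of "int m + int n"]], of "1/2"]
      by (simp add: cos_times_cos left_diff_distrib distrib_right)
  next
    case (sin n)
    show ?case
      using trig_poly.scale[OF trig_poly_diff[OF trig_poly_sin_int[of "int m + int n"] trig_poly_sin_int[of "int m - int n"]], of "1/2"]
      by (simp add: cos_times_sin left_diff_distrib distrib_right)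
  qed (auto dest: trig_poly.intros(3) trig_poly.intros(4) simp: distrib_left mult.left_commute)
next
  case (sin m)
  show ?case using assms(2)
  proof induction
    case (cos n)
    show ?case
      using trig_poly.scale[OF trig_poly.add[OF trig_poly_sin_int[of "int m + int n"] trig_poly_sin_int[of "int m - int n"]], of "1/2"]
      by (simp add: sin_times_cos left_diff_distrib distrib_right)
  next
    case (sin n)
    show ?case
      using trig_poly.scale[OF trig_poly_diff[OF trig_poly_cos_int[of "int m - int n"] trig_poly_cos_int[of "int m + int n"]], of "1/2"]
      by (simp add: sin_times_sin left_diff_distrib distrib_right)
  qed (auto dest: trig_poly.intros(3) trig_poly.intros(4) simp: distrib_left mult.left_commute)
qed (auto dest: trig_poly.intros(3) trig_poly.intros(4) simp: distrib_right mult.assoc)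

lemma trig_poly_continuous: "trig_poly g \<Longrightarrow> continuous_on S g"
  by (induction rule: trig_poly.induct) (auto intro!: continuous_intros)

lemma trig_poly_periodic: "trig_poly g \<Longrightarrow> g (t + 2 * pi) = g t"
proof (induction rule: trig_poly.induct)
  case (cos m) show ?case using cos.plus_of_nat[of "m*t" m] by (simp add: algebra_simps)
next
  case (sin m) show ?case using sin.plus_of_nat[of "m*t" m] by (simp add: algebra_simps)
qed auto

lemma real_polynomial_function_on_circle:
  fixes p :: "complex \<Rightarrow> real"
  assumes "real_polynomial_function p"
  shows "trig_poly (\<lambda>t. p (cis t))"
  using assms
proof induction
  case (linear f)
  then interpret bounded_linear f .
  have "f (cis t) = f 1 * cos (real 1 * t) + f \<i> * sin (real 1 * t)" for t
  proof -
    have "cis t = cos t *\<^sub>R 1 + sin t *\<^sub>R \<i>" by (simp add: complex_eq_iff)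
    then show ?thesis by (simp add: add scaleR)
  qed
  then show ?case
    using trig_poly.add[OF trig_poly.scale[OF trig_poly.cos[of 1], of "f 1"] trig_poly.scale[OF trig_poly.sin[of 1], of "f \<i>"]]
    by simp
qed (auto intro: trig_poly_const trig_poly.add trig_poly_mult)

text \<open>A periodic function factors through the unit circle.\<close>

lemma periodic_cis_cong:
  assumes "\<And>t. h (t + 2 * pi) = h t" "cis s = cis t"
  shows "h s = h t"
proof -
  interpret periodic_fun_simple h "2 * pi" by standard (rule assms(1))
  obtain n :: int where "s = t + 2 * pi * n"
    using assms(2) sin_cos_eq_iff[of s t] by (auto simp: complex_eq_iff)
  then show ?thesis using plus_of_int[of t n] by (simp add: mult.commute)
qed

text \<open>Composing \<open>h\<close> with the argument gives a continuous function on the unit circle, to which the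
Stone-Weierstrass theorem applies; a polynomial in the real and imaginary parts of \<open>e\<^sup>i\<^sup>t\<close> is a
trigonometric polynomial by the product-to-sum formulas. Continuity is in question only on the
negative real axis, where \<open>Arg\<close> jumps; there \<open>Arg z\<close> may be replaced by the continuous
\<open>Arg (-z) + \<pi>\<close>, since both represent the same angle modulo \<open>2 \<pi>\<close>.\<close>

lemma trig_poly_dense:
  fixes h :: "real \<Rightarrow> real"
  assumes cont: "continuous_on UNIV h" and per: "\<And>t. h (t + 2 * pi) = h t" and "e > 0"
  obtains g where "trig_poly g" "\<And>t. \<bar>h t - g t\<bar> < e"
proof -
  define H where "H = (\<lambda>z. h (Arg z))"
  have H_cis: "H (cis t) = h t" for t
    unfolding H_def by (rule periodic_cis_cong[where h = h, OF per]) (simp add: cis_Arg sgn_div_norm)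
  have hc: "isCont h t" for t using cont continuous_on_eq_continuous_at by blast
  have "isCont H z" if "z \<noteq> 0" for z
  proof (cases "z \<in> \<real>\<^sub>\<le>\<^sub>0")
    case False
    then show ?thesis unfolding H_def
      using continuous_at_Arg[OF False] hc isCont_o2 by blast
  next
    case True
    have "Re z < 0" using True that complex_nonpos_Reals_iff by (auto simp: complex_eq_iff)
    then have z: "- z \<notin> \<real>\<^sub>\<le>\<^sub>0" by (auto simp: complex_nonpos_Reals_iff)
    have "isCont (\<lambda>w. Arg (- w)) z"
      using continuous_at_Arg[OF z] isCont_o2[of z uminus Arg] by (simp add: isCont_minus)
    then have "isCont (\<lambda>w. h (Arg (- w) + pi)) z"
      by (intro isCont_o2[OF _ hc] continuous_intros)
    moreover have "\<forall>\<^sub>F w in nhds z. H w = h (Arg (- w) + pi)"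
    proof (rule eventually_mono[OF t1_space_nhds[OF that]])
      fix w :: complex assume "w \<noteq> 0"
      then show "H w = h (Arg (- w) + pi)" unfolding H_def
        by (intro periodic_cis_cong[where h = h, OF per]) (simp add: cis_Arg flip: cis_mult)
    qed
    ultimately show ?thesis using isCont_cong[of H "\<lambda>w. h (Arg (- w) + pi)" z] by simp
  qed
  then have "continuous_on (sphere 0 1) H"
    by (intro continuous_at_imp_continuous_on ballI) (metis mem_sphere_0 norm_zero zero_neq_one)
  then obtain p where "real_polynomial_function p" "\<And>z. z \<in> sphere 0 1 \<Longrightarrow> \<bar>H z - p z\<bar> < e"
    using Stone_Weierstrass_real_polynomial_function[of "sphere 0 1" H e] \<open>e > 0\<close> by auto
  then show ?thesis
    using that[of "\<lambda>t. p (cis t)"] real_polynomial_function_on_circle H_cis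
    by (metis mem_sphere_0 norm_cis)
qed

section \<open>Maximum principle with a slit\<close>

text \<open>If the second derivative were positive, the first derivative would be positive just to the
right of the point, and the mean value theorem would give larger values there.\<close>

lemma second_derivative_nonpos_at_max:
  fixes g g' :: "real \<Rightarrow> real"
  assumes "d > 0"
    and g': "\<And>x. \<bar>x - a\<bar> < d \<Longrightarrow> (g has_real_derivative g' x) (at x)"
    and g'': "(g' has_real_derivative D) (at a)"
    and max: "\<And>x. \<bar>x - a\<bar> < d \<Longrightarrow> g x \<le> g a"
  shows "g' a = 0" "D \<le> 0"
proof -
  show zero: "g' a = 0"
    using DERIV_local_max[OF g'[of a] \<open>d > 0\<close>] max \<open>d > 0\<close> by (simp add: abs_minus_commute)
  show "D \<le> 0"
  proof (rule ccontr)
    assume "\<not> D \<le> 0"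
    then obtain e where "e > 0" and e: "\<And>h. 0 < h \<Longrightarrow> h < e \<Longrightarrow> g' a < g' (a + h)"
      using DERIV_pos_inc_right[OF g''] by auto
    define b where "b = a + min d e / 2"
    have b: "a < b" "b - a < d" "b - a < e" using \<open>d > 0\<close> \<open>e > 0\<close> by (auto simp: b_def)
    then obtain z where "a < z" "z < b" "g b - g a = (b - a) * g' z"
      using MVT2[of a b g g'] g' by auto
    moreover have "g' z > 0" using e[of "z - a"] calculation b zero by simp
    ultimately have "g b > g a" using b by (metis diff_gt_0_iff_gt mult_pos_pos)
    then show False using max[of b] b by simp
  qed
qed

lemma periodic_2pi_representative:
  obtains s where "s \<in> {- pi..pi}" "\<And>g :: real \<Rightarrow> real. (\<And>t. g (t + 2 * pi) = g t) \<Longrightarrow> g t = g s"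
proof
  show "Arg (cis t) \<in> {- pi..pi}" using Arg_bounded[of "cis t"] by simp
  show "g t = g (Arg (cis t))" if "\<And>t. g (t + 2 * pi) = g t" for g :: "real \<Rightarrow> real"
    by (rule periodic_cis_cong[where h = g, OF that]) (simp add: cis_Arg sgn_div_norm)
qed

text \<open>
  By periodicity a maximum over the compact rectangle of one period is global.
\<close>

lemma periodic_attains_max_on_strip:
  fixes G :: "real \<Rightarrow> real \<Rightarrow> real"
  assumes "c \<le> d" and cont: "continuous_on ({c..d} \<times> UNIV) (\<lambda>(r, t). G r t)"
    and per: "\<And>r t. r \<in> {c..d} \<Longrightarrow> G r (t + 2 * pi) = G r t"
  obtains r0 t0 where "r0 \<in> {c..d}" "\<And>r t. r \<in> {c..d} \<Longrightarrow> G r t \<le> G r0 t0"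
proof -
  have "continuous_on ({c..d} \<times> {- pi..pi}) (\<lambda>(r, t). G r t)"
    by (rule continuous_on_subset[OF cont]) auto
  then obtain z where z: "z \<in> {c..d} \<times> {- pi..pi}"
    "\<And>y. y \<in> {c..d} \<times> {- pi..pi} \<Longrightarrow> (case y of (r, t) \<Rightarrow> G r t) \<le> (case z of (r, t) \<Rightarrow> G r t)"
    using continuous_attains_sup[of "{c..d} \<times> {- pi..pi}" "\<lambda>(r, t). G r t"] \<open>c \<le> d\<close>
    by (auto simp: compact_Times)
  have "G r t \<le> G (fst z) (snd z)" if r: "r \<in> {c..d}" for r t
  proof -
    obtain s where "s \<in> {- pi..pi}" "G r t = G r s"
      using periodic_2pi_representative[of t] per[OF r] by metis
    then show ?thesis using z(2)[of "(r, s)"] r by (simp add: case_prod_unfold)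
  qed
  then show ?thesis using that[of "fst z" "snd z"] z(1) by (auto simp: mem_Times_iff)
qed

lemma strictly_subharmonic_no_interior_max:
  fixes G Gr Gt :: "real \<Rightarrow> real \<Rightarrow> real"
  assumes r0: "0 < c" "c < r0" "r0 < d"
    and max: "\<And>r t. r \<in> {c..d} \<Longrightarrow> G r t \<le> G r0 t0"
    and Gr: "\<And>r t. c < r \<Longrightarrow> r < d \<Longrightarrow> ((\<lambda>s. G s t) has_real_derivative Gr r t) (at r)"
    and Grr: "((\<lambda>s. Gr s t0) has_real_derivative Grr) (at r0)"
    and Gt: "\<And>t. ((\<lambda>s. G r0 s) has_real_derivative Gt r0 t) (at t)"
    and Gtt: "((\<lambda>s. Gt r0 s) has_real_derivative Gtt) (at t0)"
  shows "Grr + 1 / r0 * Gr r0 t0 + 1 / r0\<^sup>2 * Gtt \<le> 0"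
proof -
  have "Gr r0 t0 = 0" "Grr \<le> 0"
    by (rule second_derivative_nonpos_at_max[of "min (r0 - c) (d - r0)" r0 "\<lambda>s. G s t0" "\<lambda>s. Gr s t0" Grr];
        use r0 max Gr Grr in \<open>auto simp: abs_less_iff\<close>)+
  moreover have "Gtt \<le> 0"
    by (rule second_derivative_nonpos_at_max[of 1 t0 "\<lambda>s. G r0 s" "\<lambda>s. Gt r0 s" Gtt];
        use r0 max Gt Gtt in auto)
  then have "1 / r0\<^sup>2 * Gtt \<le> 0" by (intro mult_nonneg_nonpos) auto
  ultimately show ?thesis by simp
qed

lemma has_derivative_nonpos_at_left_end_max:
  fixes g :: "real \<Rightarrow> real"
  assumes "(g has_real_derivative D) (at a within {a..b})" "a < b"
    and "\<And>x. x \<in> {a..b} \<Longrightarrow> g x \<le> g a"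
  shows "D \<le> 0"
proof (rule ccontr)
  assume "\<not> D \<le> 0"
  then obtain e where "e > 0" and e: "\<And>h. 0 < h \<Longrightarrow> a + h \<in> {a..b} \<Longrightarrow> h < e \<Longrightarrow> g a < g (a + h)"
    using has_real_derivative_pos_inc_right[OF assms(1)] by auto
  define h where "h = min e (b - a) / 2"
  have "0 < h" "h < e" "a + h \<in> {a..b}" using \<open>e > 0\<close> \<open>a < b\<close> by (auto simp: h_def field_simps min_def)
  then show False using e[of h] assms(3)[of "a + h"] by force
qed

text \<open>
  \<open>slit_dirichlet_solution\<close> with the derivatives as parameters, so that each clause
  can be cited by name.
\<close>

locale slit_solution =
  fixes q :: real and h :: "real \<Rightarrow> real" and f fr frr ft ftt :: "real \<Rightarrow> real \<Rightarrow> real"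
  assumes cont: "continuous_on ({q..1} \<times> UNIV) (\<lambda>(r, \<theta>). f r \<theta>)"
    and periodic: "r \<in> {q..1} \<Longrightarrow> f r (\<theta> + 2 * pi) = f r \<theta>"
    and fr: "r \<in> {q..<1} \<Longrightarrow> 0 < r \<Longrightarrow> ((\<lambda>s. f s \<theta>) has_real_derivative fr r \<theta>) (at r within {q..1})"
    and frr: "r \<in> {q..<1} \<Longrightarrow> 0 < r \<Longrightarrow> ((\<lambda>s. fr s \<theta>) has_real_derivative frr r \<theta>) (at r within {q..1})"
    and ft: "r \<in> {q..<1} \<Longrightarrow> 0 < r \<Longrightarrow> ((\<lambda>t. f r t) has_real_derivative ft r \<theta>) (at \<theta>)"
    and ftt: "r \<in> {q..<1} \<Longrightarrow> 0 < r \<Longrightarrow> ((\<lambda>t. ft r t) has_real_derivative ftt r \<theta>) (at \<theta>)"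
    and laplace: "r \<in> {q..<1} \<Longrightarrow> 0 < r \<Longrightarrow> frr r \<theta> + 1 / r * fr r \<theta> + 1 / r\<^sup>2 * ftt r \<theta> = 0"
    and slope_odd: "0 < q \<Longrightarrow> fr q \<theta> = - fr q (- \<theta>)"
    and boundary: "f 1 \<theta> = h \<theta>"
    and value_even: "f q \<theta> = f q (- \<theta>)"

lemma slit_dirichlet_solution_iff:
  "slit_dirichlet_solution q h f \<longleftrightarrow> (\<exists>fr frr ft ftt. slit_solution q h f fr frr ft ftt)"
  (is "_ \<longleftrightarrow> ?R")
proof
  assume "slit_dirichlet_solution q h f"
  then obtain fr frr ft ftt where *:
    "continuous_on ({q..1} \<times> UNIV) (\<lambda>(r, \<theta>). f r \<theta>)"
    "\<forall>r\<in>{q..1}. \<forall>\<theta>. f r (\<theta> + 2 * pi) = f r \<theta>"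
    "\<forall>r\<in>{q..<1}. \<forall>\<theta>. 0 < r \<longrightarrow>
       ((\<lambda>s. f s \<theta>) has_real_derivative fr r \<theta>) (at r within {q..1}) \<and>
       ((\<lambda>s. fr s \<theta>) has_real_derivative frr r \<theta>) (at r within {q..1}) \<and>
       ((\<lambda>t. f r t) has_real_derivative ft r \<theta>) (at \<theta>) \<and>
       ((\<lambda>t. ft r t) has_real_derivative ftt r \<theta>) (at \<theta>) \<and>
       frr r \<theta> + 1 / r * fr r \<theta> + 1 / r\<^sup>2 * ftt r \<theta> = 0"
    "0 < q \<longrightarrow> (\<forall>\<theta>. fr q \<theta> = - fr q (- \<theta>))"
    "\<forall>\<theta>. f 1 \<theta> = h \<theta>" "\<forall>\<theta>. f q \<theta> = f q (- \<theta>)"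
    unfolding slit_dirichlet_solution_def by (elim conjE exE) (rule that)
  have "slit_solution q h f fr frr ft ftt"
    by unfold_locales
      ((rule *(1) *(2)[rule_format] *(3)[rule_format, THEN conjunct1]
          *(3)[rule_format, THEN conjunct2, THEN conjunct1]
          *(3)[rule_format, THEN conjunct2, THEN conjunct2, THEN conjunct1]
          *(3)[rule_format, THEN conjunct2, THEN conjunct2, THEN conjunct2, THEN conjunct1]
          *(3)[rule_format, THEN conjunct2, THEN conjunct2, THEN conjunct2, THEN conjunct2]
          *(4-6)[rule_format]; assumption)+)
  then show ?R by blast
next
  assume ?R
  then obtain fr frr ft ftt where "slit_solution q h f fr frr ft ftt" by blast
  then interpret slit_solution q h f fr frr ft ftt .
  show "slit_dirichlet_solution q h f"
    unfolding slit_dirichlet_solution_def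
    by (intro conjI allI ballI, fact cont, erule periodic, rule exI[of _ fr], rule exI[of _ frr],
        rule exI[of _ ft], rule exI[of _ ftt])
      (intro conjI allI ballI impI fr frr ft ftt laplace slope_odd boundary value_even; assumption)+
qed

lemma slit_dirichlet_solution_diff:
  assumes "slit_dirichlet_solution q h f" "slit_dirichlet_solution q k g"
  shows "slit_dirichlet_solution q (\<lambda>\<theta>. h \<theta> - k \<theta>) (\<lambda>r \<theta>. f r \<theta> - g r \<theta>)"
proof -
  obtain fr frr ft ftt gr grr gt gtt where
    fg: "slit_solution q h f fr frr ft ftt" "slit_solution q k g gr grr gt gtt"
    using assms unfolding slit_dirichlet_solution_iff by blast
  interpret f: slit_solution q h f fr frr ft ftt by (fact fg)
  interpret g: slit_solution q k g gr grr gt gtt by (fact fg)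
  have "slit_solution q (\<lambda>\<theta>. h \<theta> - k \<theta>) (\<lambda>r \<theta>. f r \<theta> - g r \<theta>)
    (\<lambda>r \<theta>. fr r \<theta> - gr r \<theta>) (\<lambda>r \<theta>. frr r \<theta> - grr r \<theta>)
    (\<lambda>r \<theta>. ft r \<theta> - gt r \<theta>) (\<lambda>r \<theta>. ftt r \<theta> - gtt r \<theta>)"
  proof
    show "continuous_on ({q..1} \<times> UNIV) (\<lambda>(r, \<theta>). f r \<theta> - g r \<theta>)"
      using continuous_on_diff[OF f.cont g.cont] by (simp add: case_prod_unfold)
    show "frr r \<theta> - grr r \<theta> + 1 / r * (fr r \<theta> - gr r \<theta>) + 1 / r\<^sup>2 * (ftt r \<theta> - gtt r \<theta>) = 0"
      if "r \<in> {q..<1}" "0 < r" for r \<theta>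
      using f.laplace[OF that, of \<theta>] g.laplace[OF that, of \<theta>] by (simp add: diff_divide_distrib)
    show "fr q \<theta> - gr q \<theta> = - (fr q (- \<theta>) - gr q (- \<theta>))" if "0 < q" for \<theta>
      using f.slope_odd[OF that, of \<theta>] g.slope_odd[OF that, of \<theta>] by simp
    show "f q \<theta> - g q \<theta> = f q (- \<theta>) - g q (- \<theta>)" for \<theta>
      using f.value_even[of \<theta>] g.value_even[of \<theta>] by simp
  qed (auto intro!: DERIV_diff f.fr g.fr f.frr g.frr f.ft g.ft f.ftt g.ftt
      simp: f.periodic g.periodic f.boundary g.boundary)
  then show ?thesis unfolding slit_dirichlet_solution_iff by blast
qed

text \<open>The barrier \<open>\<phi>(r) = ln r + r\<^sup>2\<close> has \<open>\<phi>'' + \<phi>'/r = 4\<close>, since \<open>ln r\<close> is harmonic and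
\<open>r\<^sup>2\<close> contributes \<open>4\<close>; it is increasing, which excludes a maximum on the slit; and it tends
to \<open>-\<infinity>\<close> at the origin, which handles the case \<open>q = 0\<close>, where the equation says nothing at
\<open>r = 0\<close>. At \<open>r = 1\<close> it equals \<open>1\<close>, whence the bound \<open>M + \<epsilon>\<close>.\<close>

lemma slit_dirichlet_solution_barrier_bound:
  assumes sol: "slit_dirichlet_solution q h f" and "0 \<le> q" "q < 1"
    and h: "\<And>\<theta>. h \<theta> \<le> M" and "0 < \<epsilon>" and r: "r \<in> {q..1}" "0 < r"
  shows "f r \<theta> + \<epsilon> * (ln r + r\<^sup>2) \<le> M + \<epsilon>"
proof -
  obtain fr frr ft ftt where "slit_solution q h f fr frr ft ftt"
    using sol unfolding slit_dirichlet_solution_iff by blast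
  then interpret slit_solution q h f fr frr ft ftt .
  define G where "G = (\<lambda>r \<theta>. f r \<theta> + \<epsilon> * (ln r + r\<^sup>2))"
  \<comment> \<open>The inner radius is the slit if there is one; otherwise it is so small that the
    logarithm alone forces the bound on the inner circle.\<close>
  obtain c where c: "0 < c" "q \<le> c" "c < 1" "c \<le> r" and c_bound: "c = q \<or> (\<forall>\<theta>. G c \<theta> \<le> M + \<epsilon>)"
  proof (cases "q > 0")
    case True
    then show thesis using that[of q] assms by auto
  next
    case False
    obtain B where B: "\<And>s \<theta>. s \<in> {q..1} \<Longrightarrow> f s \<theta> \<le> B"
      using periodic_attains_max_on_strip[of q 1 f] cont periodic \<open>q < 1\<close> by (metis less_imp_le)
    define c where "c = Min {r, 1/2, exp ((M - B) / \<epsilon>)}"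
    have c: "0 < c" "q \<le> c" "c < 1" "c \<le> r" "c \<le> exp ((M - B) / \<epsilon>)"
      using False r by (auto simp: c_def not_less intro: order_trans[of q 0])
    then have "ln c \<le> (M - B) / \<epsilon>" by (metis ln_exp ln_le_cancel_iff exp_gt_zero)
    then have "\<epsilon> * ln c \<le> M - B" using \<open>0 < \<epsilon>\<close> by (simp add: field_simps)
    moreover have "\<epsilon> * c\<^sup>2 \<le> \<epsilon>" using c \<open>0 < \<epsilon>\<close> by (simp add: abs_square_le_1)
    ultimately have "G c \<theta> \<le> M + \<epsilon>" for \<theta>
      using B[of c \<theta>] c by (simp add: G_def distrib_left)
    then show thesis using that[of c] c by auto
  qed
  have "continuous_on ({c..1} \<times> UNIV) (\<lambda>(r, \<theta>). f r \<theta>)"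
    by (rule continuous_on_subset[OF cont]) (use c in auto)
  then have "continuous_on ({c..1} \<times> UNIV) (\<lambda>(r, \<theta>). G r \<theta>)"
    unfolding G_def case_prod_unfold using c by (auto intro!: continuous_intros)
  then obtain r0 t0 where r0: "r0 \<in> {c..1}" and max: "\<And>s t. s \<in> {c..1} \<Longrightarrow> G s t \<le> G r0 t0"
    using periodic_attains_max_on_strip[of c 1 G] c periodic by (auto simp: G_def)
  have Gr: "((\<lambda>s. G s t) has_real_derivative fr s t + \<epsilon> * (1 / s + 2 * s)) (at s within {q..1})"
    if "s \<in> {q..<1}" "0 < s" for s t
    unfolding G_def using that by (auto intro!: derivative_eq_intros fr)
  have "G r0 t0 \<le> M + \<epsilon>"
  proof -
    consider "r0 = 1" | "r0 = c" "c = q" | "r0 = c" "c \<noteq> q" | "c < r0" "r0 < 1" using r0 by fastforce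
    then show ?thesis
    proof cases
      case 1 then show ?thesis using boundary[of t0] h[of t0] \<open>0 < \<epsilon>\<close> by (simp add: G_def)
    next
      case 2
      \<comment> \<open>A maximum on the slit occurs at both conjugate angles; the two nonpositive slopes
        add up to twice the slope of the barrier, which is positive.\<close>
      have "0 < q" using c 2 by simp
      have le0: "fr q t + \<epsilon> * (1 / q + 2 * q) \<le> 0" if "G q t = G q t0" for t
        using has_derivative_nonpos_at_left_end_max[OF Gr[of q t]] \<open>0 < q\<close> \<open>q < 1\<close> max 2 that by simp
      have "G q (- t0) = G q t0" using value_even[of t0] by (simp add: G_def)
      then have "2 * (\<epsilon> * (1 / q + 2 * q)) \<le> 0"
        using le0[of t0] le0[of "- t0"] slope_odd[of t0] \<open>0 < q\<close> by simp
      moreover have "\<epsilon> * (1 / q + 2 * q) > 0" using \<open>0 < q\<close> \<open>0 < \<epsilon>\<close> by (simp add: add_pos_pos)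
      ultimately show ?thesis by simp
    next
      case 3 then show ?thesis using c_bound by auto
    next
      case 4
      have at: "at s within {q..1} = at s" if "c < s" "s < 1" for s
        using that c by (intro at_within_interior) (auto simp: interior_atLeastAtMost_real)
      have r0q: "r0 \<in> {q..<1}" "0 < r0" using 4 c by auto
      have "frr r0 t0 + \<epsilon> * (2 - 1 / r0\<^sup>2) + 1 / r0 * (fr r0 t0 + \<epsilon> * (1 / r0 + 2 * r0)) + 1 / r0\<^sup>2 * ftt r0 t0 \<le> 0"
      proof (rule strictly_subharmonic_no_interior_max[where G = G and c = c and d = 1 and Gr = "\<lambda>s t. fr s t + \<epsilon> * (1 / s + 2 * s)" and Gt = ft])
        show "((\<lambda>s. G s t) has_real_derivative fr s t + \<epsilon> * (1 / s + 2 * s)) (at s)"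
          if "c < s" "s < 1" for s t
          using Gr[of s t] that c at[of s] by simp
        have "((\<lambda>s. fr s t0) has_real_derivative frr r0 t0) (at r0)"
          using frr[OF r0q, of t0] at[of r0] 4 by simp
        then show "((\<lambda>s. fr s t0 + \<epsilon> * (1 / s + 2 * s)) has_real_derivative frr r0 t0 + \<epsilon> * (2 - 1 / r0\<^sup>2)) (at r0)"
          using r0q by (auto intro!: derivative_eq_intros simp: power2_eq_square)
        show "((\<lambda>s. G r0 s) has_real_derivative ft r0 t) (at t)" for t
          unfolding G_def using r0q by (auto intro!: derivative_eq_intros ft)
      qed (use 4 c max ftt r0q in auto)
      moreover have "\<epsilon> * (2 - 1 / r0\<^sup>2) + 1 / r0 * (\<epsilon> * (1 / r0 + 2 * r0)) = 4 * \<epsilon>"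
        using r0q by (simp add: field_simps power2_eq_square)
      ultimately show ?thesis using laplace[OF r0q, of t0] \<open>0 < \<epsilon>\<close> by (simp add: distrib_left)
    qed
  qed
  then show ?thesis using max[of r \<theta>] r c by (simp add: G_def)
qed

text \<open>
  Let \<open>\<epsilon>\<close> tend to \<open>0\<close> at a fixed \<open>r > 0\<close>; the
  origin follows by continuity.
\<close>

lemma slit_maximum_principle:
  assumes sol: "slit_dirichlet_solution q h f" and "0 \<le> q" "q < 1"
    and h: "\<And>\<theta>. h \<theta> \<le> M" and r: "r \<in> {q..1}"
  shows "f r \<theta> \<le> M"
proof -
  have pos: "f s \<theta> \<le> M" if s: "s \<in> {q..1}" "0 < s" for s
  proof (rule tendsto_le[OF trivial_limit_at_right_real _ tendsto_const])
    show "((\<lambda>\<epsilon>. M + \<epsilon> - \<epsilon> * (ln s + s\<^sup>2)) \<longlongrightarrow> M) (at_right 0)"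
      by (auto intro!: tendsto_eq_intros)
    show "\<forall>\<^sub>F \<epsilon> in at_right 0. f s \<theta> \<le> M + \<epsilon> - \<epsilon> * (ln s + s\<^sup>2)"
      using slit_dirichlet_solution_barrier_bound[OF assms(1-4) _ s]
      by (auto simp: eventually_at_filter algebra_simps)
  qed
  show ?thesis
  proof (cases "0 < r")
    case True then show ?thesis using pos r by simp
  next
    case False
    then have "r = 0" "q = 0" using r \<open>0 \<le> q\<close> by auto
    have "continuous_on ({q..1} \<times> UNIV) (\<lambda>(r, \<theta>). f r \<theta>)"
      using sol by (simp add: slit_dirichlet_solution_def)
    moreover have "continuous_on {0..1} (\<lambda>s. (s, \<theta>))" by (intro continuous_intros)
    ultimately have "continuous_on {0..1} (\<lambda>s. f s \<theta>)"
      using continuous_on_compose2[of "{q..1} \<times> UNIV" "\<lambda>(r, \<theta>). f r \<theta>" "{0..1}" "\<lambda>s. (s, \<theta>)"]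
      by (auto simp: \<open>q = 0\<close>)
    then have "((\<lambda>s. f s \<theta>) \<longlongrightarrow> f 0 \<theta>) (at 0 within {0..1})"
      by (simp add: continuous_on_def)
    then have "((\<lambda>s. f s \<theta>) \<longlongrightarrow> f 0 \<theta>) (at_right 0)"
      by (simp add: at_within_Icc_at_right)
    moreover have "\<forall>\<^sub>F s in at_right 0. f s \<theta> \<le> M"
      using eventually_at_right_real[of 0 1] pos by (auto elim!: eventually_mono simp: \<open>q = 0\<close>)
    ultimately show ?thesis
      using tendsto_upperbound[OF _ _ trivial_limit_at_right_real] \<open>r = 0\<close> by blast
  qed
qed

lemma slit_dirichlet_solution_abs_diff_le:
  assumes "slit_dirichlet_solution q h f" "slit_dirichlet_solution q k g" "0 \<le> q" "q < 1"
    and "\<And>\<theta>. \<bar>h \<theta> - k \<theta>\<bar> \<le> M" "r \<in> {q..1}"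
  shows "\<bar>f r \<theta> - g r \<theta>\<bar> \<le> M"
proof (rule abs_leI)
  show "f r \<theta> - g r \<theta> \<le> M"
    by (rule slit_maximum_principle[OF slit_dirichlet_solution_diff[OF assms(1,2)] assms(3,4) _ assms(6)])
      (use assms(5) in \<open>auto simp: abs_le_iff\<close>)
  have "g r \<theta> - f r \<theta> \<le> M"
    by (rule slit_maximum_principle[OF slit_dirichlet_solution_diff[OF assms(2,1)] assms(3,4) _ assms(6)])
      (use assms(5) in \<open>auto simp: abs_le_iff\<close>)
  then show "- (f r \<theta> - g r \<theta>) \<le> M" by simp
qed

section \<open>The integral formula as a power series\<close>

text \<open>
  The function claimed to be the solution; at \<open>r = 1\<close> the kernel series need not
  converge, so the boundary value is prescribed.
\<close>

definition slit_potential :: "real \<Rightarrow> (real \<Rightarrow> real) \<Rightarrow> real \<Rightarrow> real \<Rightarrow> real" where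
  "slit_potential q h r \<theta> =
     (if r = 1 then h \<theta> else integral {0..2 * pi} (\<lambda>\<tau>. h \<tau> * slit_kernel q r \<theta> \<tau>))"

definition fourier_cos :: "(real \<Rightarrow> real) \<Rightarrow> nat \<Rightarrow> real" where
  "fourier_cos h k = integral {0..2 * pi} (\<lambda>\<tau>. h \<tau> * cos (k * \<tau>))"

definition fourier_sin :: "(real \<Rightarrow> real) \<Rightarrow> nat \<Rightarrow> real" where
  "fourier_sin h k = integral {0..2 * pi} (\<lambda>\<tau>. h \<tau> * sin (k * \<tau>))"

text \<open>For \<open>k = 0\<close> the second denominator is \<open>0\<close>, and so is the sine coefficient above it; the
imaginary part is then \<open>0\<close> as well.\<close>

definition slit_coeff :: "real \<Rightarrow> (real \<Rightarrow> real) \<Rightarrow> nat \<Rightarrow> complex" where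
  "slit_coeff q h k =
     Complex (fourier_cos h k / (1 + q ^ (2 * k))) (- (fourier_sin h k / (1 - q ^ (2 * k))))"

definition slit_series :: "real \<Rightarrow> (real \<Rightarrow> real) \<Rightarrow> complex \<Rightarrow> complex" where
  "slit_series q h z = (\<Sum>k. slit_coeff q h k * z ^ k)"

lemma one_minus_le_one_minus_power:
  fixes q :: real
  assumes "0 \<le> q" "q < 1" "k \<noteq> 0"
  shows "1 - q\<^sup>2 \<le> 1 - q ^ (2 * k)" "0 < 1 - q\<^sup>2"
  using power_decreasing[of 2 "2 * k" q] assms by (auto simp: power_less_one_iff abs_square_less_1)

text \<open>
  The only danger is the denominator \<open>1 - q\<^sup>2\<^sup>k\<close>, which for \<open>k \<ge> 1\<close> is at least
  \<open>1 - q\<^sup>2\<close>; for \<open>k = 0\<close> the sine part vanishes.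
\<close>

lemma slit_kernel_term_bound:
  assumes "0 \<le> q" "q < 1" "q \<le> r"
  shows "\<bar>slit_kernel_term q r \<theta> \<tau> k\<bar> \<le> (2 + 1 / (1 - q\<^sup>2)) * r ^ k"
proof (cases "k = 0")
  case True
  then show ?thesis using assms by (simp add: slit_kernel_term_def abs_square_le_1)
next
  case False
  define x where "x = (q / r) ^ (2 * k)"
  note q2 = one_minus_le_one_minus_power[OF assms(1,2) False]
  have "0 \<le> q / r" "q / r \<le> 1"
    using assms by (cases "r = 0"; auto simp: divide_le_eq)+
  then have x: "0 \<le> x" "x \<le> 1"
    unfolding x_def by (auto intro!: power_le_one)
  have "\<bar>(1 + x) / (1 + q ^ (2 * k))\<bar> \<le> 2"
    using x assms(1) frac_le[of 2 "1 + x" 1 "1 + q ^ (2 * k)"] by (simp add: abs_of_nonneg)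
  moreover have "\<bar>(1 - x) / (1 - q ^ (2 * k))\<bar> \<le> 1 / (1 - q\<^sup>2)"
    using x q2 by (auto simp: abs_of_nonneg intro!: frac_le)
  moreover have "0 \<le> 1 / (1 - q\<^sup>2)" using q2(2) by simp
  moreover have "\<bar>cos t * cos u\<bar> \<le> 1" "\<bar>sin t * sin u\<bar> \<le> 1" for t u :: real
    by (auto simp: abs_mult intro!: mult_le_one)
  ultimately have "\<bar>(1 + x) / (1 + q ^ (2 * k)) * (cos (k * \<theta>) * cos (k * \<tau>))
     + (1 - x) / (1 - q ^ (2 * k)) * (sin (k * \<theta>) * sin (k * \<tau>))\<bar> \<le> 2 * 1 + 1 / (1 - q\<^sup>2) * 1"
    by (intro order_trans[OF abs_triangle_ineq] add_mono) (unfold abs_mult[of "_ / _"], (intro mult_mono; (simp; fail)?)+)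
  from mult_left_mono[OF this, of "r ^ k"] show ?thesis
    using assms by (simp add: slit_kernel_term_def x_def abs_mult mult.assoc mult.commute[of "r ^ k"])
qed

lemma summable_slit_kernel_term:
  assumes "0 \<le> q" "q < 1" "q \<le> r" "r < 1"
  shows "summable (slit_kernel_term q r \<theta> \<tau>)"
proof (rule summable_comparison_test')
  show "summable (\<lambda>k. (2 + 1 / (1 - q\<^sup>2)) * r ^ k)"
    using assms by (intro summable_mult summable_geometric) auto
qed (use slit_kernel_term_bound[OF assms(1-3)] in auto)

text \<open>Summing from \<open>k = 0\<close> counts a full \<open>1\<close> for the constant mode, where the kernel has \<open>1/2\<close>;
the difference is the subtracted \<open>1/(2\<pi>)\<close>.\<close>

lemma slit_kernel_eq:
  assumes "0 \<le> q" "q < 1" "q \<le> r" "r < 1"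
  shows "slit_kernel q r \<theta> \<tau> = 1 / pi * (\<Sum>k. slit_kernel_term q r \<theta> \<tau> k) - 1 / (2 * pi)"
  using suminf_split_head[OF summable_slit_kernel_term[OF assms], of \<theta> \<tau>]
  by (simp add: slit_kernel_def slit_kernel_term_def[of _ _ _ _ 0] field_simps)

lemma trig_coeff_has_integral:
  assumes "continuous_on UNIV h"
  shows "((\<lambda>\<tau>. h \<tau> * cos (k * \<tau>)) has_integral fourier_cos h k) {0..2 * pi}"
    and "((\<lambda>\<tau>. h \<tau> * sin (k * \<tau>)) has_integral fourier_sin h k) {0..2 * pi}"
  unfolding fourier_cos_def fourier_sin_def
  by (intro integrable_integral integrable_continuous_interval continuous_intros
      continuous_on_subset[OF assms]; simp)+

text \<open>
  The reflection \<open>z \<mapsto> q\<^sup>2/z\<close> in polar coordinates; with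
  \<open>0\<close> as the value of division by \<open>0\<close> it also holds at the origin.
\<close>

lemma slit_inversion:
  "of_real (q\<^sup>2) / (of_real r * cis \<theta>) = of_real (q\<^sup>2 / r) * cis (- \<theta>)"
  by (simp add: field_simps flip: cis_inverse)

text \<open>Since \<open>r\<^sup>k (q/r)\<^sup>2\<^sup>k = (q\<^sup>2/r)\<^sup>k\<close> and the reflected point has angle \<open>-\<theta>\<close>, the sum
in the cosine part and the difference in the sine part come from the same complex coefficient,
applied to \<open>z\<close> and to its reflection.\<close>

lemma slit_kernel_term_has_integral:
  assumes h: "continuous_on UNIV h" and "0 \<le> q" "q \<le> r"
  shows "((\<lambda>\<tau>. h \<tau> * slit_kernel_term q r \<theta> \<tau> k) has_integral
      Re (slit_coeff q h k * (r * cis \<theta>) ^ k)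
    + Re (slit_coeff q h k * (of_real (q\<^sup>2) / (r * cis \<theta>)) ^ k)) {0..2 * pi}"
proof -
  have flip: "r ^ k * (q / r) ^ (2 * k) = (q\<^sup>2 / r) ^ k"
  proof (cases "r = 0")
    case True then show ?thesis by (cases k) auto
  next
    case False
    then have "r * (q / r)\<^sup>2 = q\<^sup>2 / r" by (simp add: power2_eq_square)
    then show ?thesis by (metis power_mult power_mult_distrib)
  qed
  define a where "a = r ^ k * ((1 + (q / r) ^ (2 * k)) / (1 + q ^ (2 * k)) * cos (k * \<theta>))"
  define b where "b = r ^ k * ((1 - (q / r) ^ (2 * k)) / (1 - q ^ (2 * k)) * sin (k * \<theta>))"
  have "((\<lambda>\<tau>. a * (h \<tau> * cos (k * \<tau>)) + b * (h \<tau> * sin (k * \<tau>)))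
      has_integral a * fourier_cos h k + b * fourier_sin h k) {0..2 * pi}"
    by (intro has_integral_add has_integral_mult_right trig_coeff_has_integral h)
  moreover have "a * fourier_cos h k + b * fourier_sin h k =
     Re (slit_coeff q h k * (r * cis \<theta>) ^ k)
   + Re (slit_coeff q h k * (of_real (q\<^sup>2) / (r * cis \<theta>)) ^ k)"
  proof -
    have "a = (r ^ k + (q\<^sup>2 / r) ^ k) * cos (k * \<theta>) / (1 + q ^ (2 * k))"
      "b = (r ^ k - (q\<^sup>2 / r) ^ k) * sin (k * \<theta>) / (1 - q ^ (2 * k))"
      by (simp_all add: a_def b_def flip[symmetric] algebra_simps)
    then show ?thesis
      unfolding slit_inversion power_mult_distrib Complex.DeMoivre of_real_power[symmetric]
      by (simp add: slit_coeff_def) (simp add: algebra_simps add_divide_distrib diff_divide_distrib)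
  qed
  moreover have "(\<lambda>\<tau>::real. h \<tau> * slit_kernel_term q r \<theta> \<tau> k) =
      (\<lambda>\<tau>::real. a * (h \<tau> * cos (k * \<tau>)) + b * (h \<tau> * sin (k * \<tau>)))"
    by (simp add: slit_kernel_term_def a_def b_def algebra_simps)
  ultimately show ?thesis by simp
qed

lemma continuous_bounded_on_period:
  fixes h :: "real \<Rightarrow> real"
  assumes "continuous_on UNIV h"
  obtains B where "B \<ge> 0" "\<And>t. t \<in> {0..2 * pi} \<Longrightarrow> \<bar>h t\<bar> \<le> B"
proof -
  have "compact (h ` {0..2 * pi})"
    by (intro compact_continuous_image continuous_on_subset[OF assms]) auto
  then have "bounded (h ` {0..2 * pi})" by (rule compact_imp_bounded)
  then obtain B where "B > 0" "\<forall>x\<in>h ` {0..2 * pi}. norm x \<le> B" unfolding bounded_pos by blast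
  then show ?thesis using that[of B] by auto
qed

lemma summable_slit_series:
  assumes h: "continuous_on UNIV h" and "0 \<le> q" "q < 1" "norm z < 1"
  shows "summable (\<lambda>k. slit_coeff q h k * z ^ k)"
proof -
  obtain B where B: "B \<ge> 0" "\<And>t. t \<in> {0..2 * pi} \<Longrightarrow> \<bar>h t\<bar> \<le> B"
    using continuous_bounded_on_period[OF h] by blast
  have coeff: "\<bar>fourier_cos h k\<bar> \<le> B * (2 * pi)" "\<bar>fourier_sin h k\<bar> \<le> B * (2 * pi)" for k
    using has_integral_bound_real[OF B(1) finite.emptyI trig_coeff_has_integral(1)[OF h, of k]]
      has_integral_bound_real[OF B(1) finite.emptyI trig_coeff_has_integral(2)[OF h, of k]]
      mult_mono[OF B(2) abs_cos_le_one] mult_mono[OF B(2) abs_sin_le_one] B(1)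
    by (force simp: abs_mult)+
  define D where "D = B * (2 * pi) + B * (2 * pi) / (1 - q\<^sup>2)"
  have bound: "norm (slit_coeff q h k) \<le> D" if "k \<noteq> 0" for k
  proof -
    note q2 = one_minus_le_one_minus_power[OF assms(2,3) that]
    have "\<bar>fourier_cos h k / (1 + q ^ (2 * k))\<bar> \<le> B * (2 * pi) / 1"
      unfolding abs_divide using coeff(1)[of k] assms(2) by (intro frac_le) auto
    moreover have "\<bar>fourier_sin h k / (1 - q ^ (2 * k))\<bar> \<le> B * (2 * pi) / (1 - q\<^sup>2)"
      unfolding abs_divide using coeff(2)[of k] q2 by (intro frac_le) auto
    ultimately show ?thesis
      using cmod_le[of "slit_coeff q h k"] by (simp add: slit_coeff_def D_def)
  qed
  show ?thesis
  proof (rule summable_comparison_test'[where N = 1])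
    show "summable (\<lambda>k. D * norm z ^ k)"
      using assms(4) by (intro summable_mult summable_geometric) auto
    show "norm (slit_coeff q h k * z ^ k) \<le> D * norm z ^ k" if "k \<ge> 1" for k
      using bound[of k] that by (simp add: norm_mult norm_power mult_right_mono)
  qed
qed

lemma norm_slit_reflection_less_1:
  assumes "0 \<le> q" "q < 1" "q \<le> r"
  shows "norm (of_real (q\<^sup>2) / (of_real r * cis \<theta>)) < 1"
proof (cases "q = 0")
  case False
  then have "q\<^sup>2 < q" using assms by (simp add: power2_eq_square)
  then show ?thesis using assms False by (simp add: norm_divide norm_mult norm_power divide_less_eq)
qed simp

text \<open>
  For \<open>r < 1\<close> the kernel series converges uniformly in \<open>\<tau>\<close> by
  comparison with a geometric series, so it may be integrated term by term.
\<close>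

lemma slit_integral_eq_series:
  assumes h: "continuous_on UNIV h" and q: "0 \<le> q" "q < 1" and r: "q \<le> r" "r < 1"
  shows "((\<lambda>\<tau>. h \<tau> * slit_kernel q r \<theta> \<tau>) has_integral
    (Re (slit_series q h (r * cis \<theta>)) + Re (slit_series q h (of_real (q\<^sup>2) / (r * cis \<theta>)))) / pi
      - fourier_cos h 0 / (2 * pi)) {0..2 * pi}"
proof -
  let ?K = "slit_kernel_term q r \<theta>"
  obtain B where B: "B \<ge> 0" "\<And>t. t \<in> {0..2 * pi} \<Longrightarrow> \<bar>h t\<bar> \<le> B"
    using continuous_bounded_on_period[OF h] by blast
  have "uniform_limit {0..2 * pi} (\<lambda>n \<tau>. \<Sum>k<n. h \<tau> * ?K \<tau> k) (\<lambda>\<tau>. \<Sum>k. h \<tau> * ?K \<tau> k) sequentially"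
  proof (rule Weierstrass_m_test)
    show "norm (h \<tau> * ?K \<tau> k) \<le> B * ((2 + 1 / (1 - q\<^sup>2)) * r ^ k)" if "\<tau> \<in> {0..2 * pi}" for k \<tau>
      unfolding real_norm_def abs_mult
      using B that slit_kernel_term_bound[OF q r(1)] by (intro mult_mono) auto
    show "summable (\<lambda>k. B * ((2 + 1 / (1 - q\<^sup>2)) * r ^ k))"
      using q r by (intro summable_mult summable_geometric) auto
  qed
  moreover have "continuous_on {0..2 * pi} (\<lambda>\<tau>. \<Sum>k<n. h \<tau> * ?K \<tau> k)" for n
    unfolding slit_kernel_term_def
    by (intro continuous_intros continuous_on_subset[OF h]) auto
  ultimately obtain I J where I: "\<And>n. ((\<lambda>\<tau>. \<Sum>k<n. h \<tau> * ?K \<tau> k) has_integral I n) {0..2 * pi}"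
    and J: "((\<lambda>\<tau>. \<Sum>k. h \<tau> * ?K \<tau> k) has_integral J) {0..2 * pi}" and lim: "I \<longlonglongrightarrow> J"
    using uniform_limit_integral[OF _ _ sequentially_bot] by blast
  let ?c = "\<lambda>z k. Re (slit_coeff q h k * z ^ k)"
  let ?z = "complex_of_real r * cis \<theta>" and ?w = "of_real (q\<^sup>2) / (complex_of_real r * cis \<theta>)"
  have "I = (\<lambda>n. \<Sum>k<n. ?c ?z k + ?c ?w k)"
    by (rule ext, rule has_integral_unique[OF I has_integral_sum])
      (use slit_kernel_term_has_integral[OF h q(1) r(1)] in auto)
  with lim have "(\<lambda>k. ?c ?z k + ?c ?w k) sums J"
    unfolding sums_def by (simp only:)
  moreover have series: "?c z sums Re (slit_series q h z)" if "norm z < 1" for z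
    unfolding slit_series_def by (intro sums_Re summable_sums summable_slit_series h q that)
  have "norm ?z < 1" "norm ?w < 1"
    using q r norm_slit_reflection_less_1[OF q] by (auto simp: norm_mult)
  from sums_add[OF this[THEN series]]
  have "(\<lambda>k. ?c ?z k + ?c ?w k) sums (Re (slit_series q h ?z) + Re (slit_series q h ?w))" .
  ultimately have J_eq: "J = Re (slit_series q h ?z) + Re (slit_series q h ?w)"
    by (rule sums_unique2)
  have "((\<lambda>\<tau>. (\<Sum>k. h \<tau> * ?K \<tau> k) / pi - h \<tau> * cos (real 0 * \<tau>) / (2 * pi)) has_integral
      J / pi - fourier_cos h 0 / (2 * pi)) {0..2 * pi}"
    by (intro has_integral_diff has_integral_divide J trig_coeff_has_integral h)
  moreover have "(\<Sum>k. h \<tau> * ?K \<tau> k) / pi - h \<tau> * cos (real 0 * \<tau>) / (2 * pi) = h \<tau> * slit_kernel q r \<theta> \<tau>" for \<tau>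
  proof -
    define S where "S = (\<Sum>k. ?K \<tau> k)"
    have "(\<Sum>k. h \<tau> * ?K \<tau> k) = h \<tau> * S"
      unfolding S_def by (rule suminf_mult[OF summable_slit_kernel_term[OF q r]])
    then show ?thesis
      unfolding slit_kernel_eq[OF q r] S_def[symmetric] by (simp add: field_simps)
  qed
  ultimately show ?thesis unfolding J_eq by simp
qed

lemma slit_potential_eq_series:
  assumes "continuous_on UNIV h" "0 \<le> q" "q < 1" "q \<le> r" "r < 1"
  shows "slit_potential q h r \<theta> =
    (Re (slit_series q h (r * cis \<theta>)) + Re (slit_series q h (of_real (q\<^sup>2) / (r * cis \<theta>)))) / pi
      - fourier_cos h 0 / (2 * pi)"
  using slit_integral_eq_series[OF assms, THEN integral_unique] assms(5)
  by (simp add: slit_potential_def)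

section \<open>Laplace equation and matching across the slit\<close>

lemma has_real_derivative_radial:
  assumes "(\<Psi> has_field_derivative D) (at (of_real r * cis \<theta>))"
  shows "((\<lambda>s. Re (c * \<Psi> (of_real s * cis \<theta>))) has_real_derivative Re (c * cis \<theta> * D)) (at r)"
proof -
  have "((\<lambda>s. of_real s * cis \<theta>) has_vector_derivative cis \<theta>) (at r)"
    using has_vector_derivative_mult_left[OF has_vector_derivative_of_real[OF DERIV_ident], where a = "cis \<theta>"]
    by simp
  from field_vector_diff_chain_at[OF this assms]
  have "((\<lambda>s. c * \<Psi> (of_real s * cis \<theta>)) has_vector_derivative c * (cis \<theta> * D)) (at r)"
    by (intro has_vector_derivative_mult_right) (simp add: o_def)
  from bounded_linear.has_vector_derivative[OF bounded_linear_Re this]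
  show ?thesis unfolding has_real_derivative_iff_has_vector_derivative by (simp only: mult.assoc)
qed

lemma has_real_derivative_angular:
  assumes "(\<Psi> has_field_derivative D) (at (of_real r * cis \<theta>))"
  shows "((\<lambda>t. Re (\<Psi> (of_real r * cis t))) has_real_derivative Re (\<i> * (of_real r * cis \<theta>) * D)) (at \<theta>)"
proof -
  have "(cis has_vector_derivative \<i> * cis \<theta>) (at \<theta>)"
    unfolding has_vector_derivative_def by (rule has_derivative_cis[OF has_derivative_ident])
  then have "((\<lambda>t. of_real r * cis t) has_vector_derivative of_real r * (\<i> * cis \<theta>)) (at \<theta>)"
    by (rule has_vector_derivative_mult_right)
  from field_vector_diff_chain_at[OF this assms]
  have "((\<lambda>t. \<Psi> (of_real r * cis t)) has_vector_derivative (of_real r * (\<i> * cis \<theta>)) * D) (at \<theta>)"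
    by (simp add: o_def)
  from bounded_linear.has_vector_derivative[OF bounded_linear_Re this]
  show ?thesis unfolding has_real_derivative_iff_has_vector_derivative by (simp only: mult_ac)
qed

lemma slit_series_holomorphic:
  assumes "continuous_on UNIV h" "0 \<le> q" "q < 1"
  shows "slit_series q h holomorphic_on ball 0 1"
proof (rule power_series_holomorphic)
  show "(\<lambda>k. slit_coeff q h k * (w - 0) ^ k) sums slit_series q h w" if "w \<in> ball 0 1" for w
    using summable_slit_series[OF assms, of w] that by (simp add: slit_series_def summable_sums)
qed

text \<open>All conditions except continuity hold because the potential is the real part of \<open>\<Phi>\<close>, up to
scaling and an additive constant. In polar
coordinates the radial derivatives of \<open>Re \<Phi>\<close> are \<open>Re (e\<^sup>i\<^sup>\<theta> \<Phi>')\<close> and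
\<open>Re (e\<^sup>2\<^sup>i\<^sup>\<theta> \<Phi>'')\<close>, and the second angular derivative is \<open>-Re (z \<Phi>' + z\<^sup>2 \<Phi>'')\<close>, so
the three terms of the equation cancel. Evenness and oddness at \<open>r = q\<close> come from the
invariance of \<open>\<Phi>\<close> under reflection, and for the slope from the chain rule applied to it.\<close>

lemma slit_potential_solution_if_continuous:
  assumes h: "continuous_on UNIV h" and per: "\<And>\<theta>. h (\<theta> + 2 * pi) = h \<theta>"
    and q: "0 \<le> q" "q < 1"
    and cont: "continuous_on ({q..1} \<times> UNIV) (\<lambda>(r, \<theta>). slit_potential q h r \<theta>)"
  shows "slit_dirichlet_solution q h (slit_potential q h)"
proof -
  define S where "S = slit_series q h"
  define \<Phi> where "\<Phi> = (\<lambda>z. S z + S (of_real (q\<^sup>2) / z))"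
  define A where "A = {z :: complex. q\<^sup>2 < norm z \<and> norm z < 1}"
  have "open A" unfolding A_def by (intro open_Collect_conj open_Collect_less continuous_intros)
  have S: "S holomorphic_on ball 0 1"
    unfolding S_def by (rule slit_series_holomorphic[OF h q])
  have inversion: "of_real (q\<^sup>2) / z \<in> ball 0 1" "z \<noteq> 0" "z \<in> ball 0 1" if "z \<in> A" for z
  proof -
    have "norm z > 0" "norm z > q\<^sup>2" "norm z < 1" using that by (auto simp: A_def intro: le_less_trans[OF zero_le_power2])
    then show "of_real (q\<^sup>2) / z \<in> ball 0 1" "z \<noteq> 0" "z \<in> ball 0 1"
      by (auto simp: norm_divide norm_power divide_less_eq)
  qed
  have S_deriv: "(S has_field_derivative deriv S z) (at z)" if "z \<in> ball 0 1" for z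
    by (rule holomorphic_derivI[OF S open_ball that])
  have \<Phi>_deriv: "(\<Phi> has_field_derivative deriv S z + deriv S (of_real (q\<^sup>2) / z) * - (of_real (q\<^sup>2) / z\<^sup>2)) (at z)"
    if "z \<in> A" for z
    unfolding \<Phi>_def using inversion[OF that]
    by (intro DERIV_add S_deriv DERIV_chain2[OF S_deriv])
      (auto intro!: derivative_eq_intros simp: power2_eq_square)
  have "\<Phi> holomorphic_on A"
    using \<Phi>_deriv \<open>open A\<close> by (auto simp: holomorphic_on_open)
  then have \<Phi>': "(\<Phi> has_field_derivative deriv \<Phi> z) (at z)"
    and \<Phi>'': "(deriv \<Phi> has_field_derivative deriv (deriv \<Phi>) z) (at z)" if "z \<in> A" for z
    using that \<open>open A\<close> by (auto intro!: holomorphic_derivI holomorphic_deriv)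
  define u where "u = (\<lambda>r \<theta>. Re (\<Phi> (of_real r * cis \<theta>)) / pi - fourier_cos h 0 / (2 * pi))"
  have pot: "slit_potential q h r \<theta> = u r \<theta>" if "r \<in> {q..<1}" for r \<theta>
    using slit_potential_eq_series[OF h q, of r \<theta>] that by (simp add: u_def \<Phi>_def S_def)
  have in_A: "of_real r * cis \<theta> \<in> A" if "r \<in> {q..<1}" "0 < r" for r \<theta>
  proof -
    have "q\<^sup>2 < r"
    proof (cases "q = 0")
      case False
      then have "q\<^sup>2 < q" using q by (simp add: power2_eq_square)
      then show ?thesis using that by simp
    qed (use that in simp)
    then show ?thesis using that by (simp add: A_def norm_mult)
  qed
  have reflect: "of_real (q\<^sup>2) / (of_real q * cis \<theta>) = of_real q * cis (- \<theta>)" for \<theta>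
    by (simp add: power2_eq_square field_simps flip: cis_inverse)
  define fr where "fr = (\<lambda>r \<theta>. Re (cis \<theta> * deriv \<Phi> (of_real r * cis \<theta>)) / pi)"
  define frr where "frr = (\<lambda>r \<theta>. Re (cis \<theta> * cis \<theta> * deriv (deriv \<Phi>) (of_real r * cis \<theta>)) / pi)"
  define ft where "ft = (\<lambda>r \<theta>. Re (\<i> * (of_real r * cis \<theta>) * deriv \<Phi> (of_real r * cis \<theta>)) / pi)"
  define ftt where "ftt = (\<lambda>r \<theta>. Re (\<i> * (of_real r * cis \<theta>) * (\<i> * deriv \<Phi> (of_real r * cis \<theta>)
      + \<i> * (of_real r * cis \<theta>) * deriv (deriv \<Phi>) (of_real r * cis \<theta>))) / pi)"
  have "slit_solution q h (slit_potential q h) fr frr ft ftt"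
  proof
    show "slit_potential q h r (\<theta> + 2 * pi) = slit_potential q h r \<theta>" if "r \<in> {q..1}" for r \<theta>
    proof (cases "r = 1")
      case True then show ?thesis by (simp add: slit_potential_def per)
    next
      case False
      have "cis (\<theta> + 2 * pi) = cis \<theta>" by (simp add: complex_eq_iff)
      then show ?thesis using False that by (simp add: pot u_def)
    qed
  next
    fix r \<theta> :: real assume r: "r \<in> {q..<1}" "0 < r"
    let ?z = "complex_of_real r * cis \<theta>"
    note z = in_A[OF r, of \<theta>]
    have "((\<lambda>s. u s \<theta>) has_real_derivative fr r \<theta>) (at r within {q..1})"
      using DERIV_diff[OF DERIV_cdivide[OF has_real_derivative_radial[OF \<Phi>'[OF z], of 1], of pi] DERIV_const]
      unfolding u_def fr_def by (simp only: mult_1 diff_zero has_field_derivative_at_within)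
    then show "((\<lambda>s. slit_potential q h s \<theta>) has_real_derivative fr r \<theta>) (at r within {q..1})"
    proof (rule has_field_derivative_transform_within)
      show "0 < 1 - r" using r by simp
    qed (use r pot in \<open>auto simp: dist_real_def\<close>)
    show "((\<lambda>s. fr s \<theta>) has_real_derivative frr r \<theta>) (at r within {q..1})"
      unfolding fr_def frr_def
      by (rule has_field_derivative_at_within[OF DERIV_cdivide[OF has_real_derivative_radial[OF \<Phi>''[OF z]]]])
    show "((\<lambda>t. slit_potential q h r t) has_real_derivative ft r \<theta>) (at \<theta>)"
      using DERIV_diff[OF DERIV_cdivide[OF has_real_derivative_angular[OF \<Phi>'[OF z]], of pi] DERIV_const]
      unfolding pot[OF r(1)] u_def ft_def by (simp only: diff_zero)
    have "((\<lambda>w. \<i> * w * deriv \<Phi> w) has_field_derivative (\<i> * deriv \<Phi> ?z + \<i> * ?z * deriv (deriv \<Phi>) ?z)) (at ?z)"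
      using DERIV_mult[OF DERIV_cmult[OF DERIV_ident, of \<i>] \<Phi>''[OF z]]
      by (simp only: mult_1_right mult.commute[of "deriv (deriv \<Phi>) ?z"])
    from has_real_derivative_angular[OF this]
    show "((\<lambda>t. ft r t) has_real_derivative ftt r \<theta>) (at \<theta>)"
      unfolding ft_def ftt_def by (rule DERIV_cdivide)
    have "\<i> * ?z * (\<i> * deriv \<Phi> ?z + \<i> * ?z * deriv (deriv \<Phi>) ?z) =
        - (r *\<^sub>R (cis \<theta> * deriv \<Phi> ?z) + r\<^sup>2 *\<^sub>R (cis \<theta> * cis \<theta> * deriv (deriv \<Phi>) ?z))"
      by (simp add: scaleR_conv_of_real algebra_simps power2_eq_square)
    then have "ftt r \<theta> = - (r * Re (cis \<theta> * deriv \<Phi> ?z) + r\<^sup>2 * Re (cis \<theta> * cis \<theta> * deriv (deriv \<Phi>) ?z)) / pi"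
      unfolding ftt_def by (simp only: scaleR_complex.sel uminus_complex.sel plus_complex.sel)
    then show "frr r \<theta> + 1 / r * fr r \<theta> + 1 / r\<^sup>2 * ftt r \<theta> = 0"
      unfolding frr_def fr_def using r by (simp only:) (simp add: field_simps power2_eq_square)
  next
    fix \<theta> :: real assume "0 < q"
    \<comment> \<open>On the slit the reflection conjugates, and its derivative times \<open>cis t\<close> is \<open>- cis (- t)\<close>.\<close>
    have slope: "fr q t = Re (cis t * deriv S (of_real q * cis t) - cis (- t) * deriv S (of_real q * cis (- t))) / pi" for t
    proof -
      have "of_real q * cis t \<in> A" using in_A[of q t] \<open>0 < q\<close> q by simp
      then have \<Phi>q: "deriv \<Phi> (of_real q * cis t) = deriv S (of_real q * cis t)
          - of_real (q\<^sup>2) / (of_real q * cis t)\<^sup>2 * deriv S (of_real q * cis (- t))"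
        using DERIV_imp_deriv[OF \<Phi>_deriv, of "of_real q * cis t"] unfolding reflect by simp
      have "cis t * (of_real (q\<^sup>2) / (of_real q * cis t)\<^sup>2) =
          (of_real (q\<^sup>2) / (of_real q * cis t)) * (cis t / (of_real q * cis t))"
        by (simp add: power2_eq_square)
      also have "\<dots> = cis (- t)"
        unfolding reflect using \<open>0 < q\<close> by simp
      finally have "cis t * deriv \<Phi> (of_real q * cis t) =
          cis t * deriv S (of_real q * cis t) - cis (- t) * deriv S (of_real q * cis (- t))"
        unfolding \<Phi>q right_diff_distrib by (simp only: mult.assoc[symmetric])
      then show ?thesis unfolding fr_def by (simp only:)
    qed
    show "fr q \<theta> = - fr q (- \<theta>)"
      unfolding slope[of \<theta>] slope[of "- \<theta>"] minus_minus minus_complex.sel minus_divide_left by simp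
  next
    fix \<theta> :: real
    have "\<Phi> (of_real q * cis (- \<theta>)) = \<Phi> (of_real q * cis \<theta>)"
      unfolding \<Phi>_def reflect by (simp only: minus_minus add.commute)
    moreover have "q \<in> {q..<1}" using q by simp
    ultimately show "slit_potential q h q \<theta> = slit_potential q h q (- \<theta>)"
      by (simp only: pot u_def)
    show "slit_potential q h 1 \<theta> = h \<theta>" by (simp add: slit_potential_def)
  qed (fact cont)
  then show ?thesis unfolding slit_dirichlet_solution_iff by blast
qed

section \<open>Boundary values\<close>

lemma has_integral_cos_int:
  "((\<lambda>t. cos (of_int n * t)) has_integral (if n = 0 then 2 * pi else 0)) {0..2 * pi}"
proof (cases "n = 0")
  case True
  then show ?thesis using has_integral_const_real[of "1 :: real" 0 "2 * pi"] by simp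
next
  case False
  have "((\<lambda>t. cos (of_int n * t)) has_integral
      sin (of_int n * (2 * pi)) / of_int n - sin (of_int n * 0) / of_int n) {0..2 * pi}"
    using False
    by (intro fundamental_theorem_of_calculus)
      (auto intro!: derivative_eq_intros simp flip: has_real_derivative_iff_has_vector_derivative)
  then show ?thesis using False sin_int_2pin[of n] by (simp add: mult.commute)
qed

lemma has_integral_sin_int: "((\<lambda>t. sin (of_int n * t)) has_integral 0) {0..2 * pi}"
proof (cases "n = 0")
  case False
  have "((\<lambda>t. sin (of_int n * t)) has_integral
      - cos (of_int n * (2 * pi)) / of_int n - - cos (of_int n * 0) / of_int n) {0..2 * pi}"
    using False
    by (intro fundamental_theorem_of_calculus)
      (auto intro!: derivative_eq_intros simp flip: has_real_derivative_iff_has_vector_derivative)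
  then show ?thesis using cos_int_2pin[of n] by (simp add: mult.commute)
qed simp

lemma fourier_coeffs_cos:
  "fourier_cos (\<lambda>t. cos (real m * t)) k = (if k = m then if m = 0 then 2 * pi else pi else 0)"
  "fourier_sin (\<lambda>t. cos (real m * t)) k = 0"
proof -
  have cc: "cos (real m * t) * cos (real k * t)
      = (cos (of_int (int m - int k) * t) + cos (of_int (int m + int k) * t)) / 2"
    and cs: "cos (real m * t) * sin (real k * t)
      = (sin (of_int (int m + int k) * t) - sin (of_int (int m - int k) * t)) / 2" for t
    by (simp_all add: cos_times_cos cos_times_sin left_diff_distrib distrib_right)
  show "fourier_cos (\<lambda>t. cos (real m * t)) k = (if k = m then if m = 0 then 2 * pi else pi else 0)"
    unfolding fourier_cos_def cc
      integral_unique[OF has_integral_divide[OF has_integral_add[OF has_integral_cos_int has_integral_cos_int]]]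
    by auto
  show "fourier_sin (\<lambda>t. cos (real m * t)) k = 0"
    unfolding fourier_sin_def cs
      integral_unique[OF has_integral_divide[OF has_integral_diff[OF has_integral_sin_int has_integral_sin_int]]]
    by simp
qed

lemma fourier_coeffs_sin:
  "fourier_cos (\<lambda>t. sin (real m * t)) k = 0"
  "fourier_sin (\<lambda>t. sin (real m * t)) k = (if k = m \<and> m \<noteq> 0 then pi else 0)"
proof -
  have sc: "sin (real m * t) * cos (real k * t)
      = (sin (of_int (int m + int k) * t) + sin (of_int (int m - int k) * t)) / 2"
    and ss: "sin (real m * t) * sin (real k * t)
      = (cos (of_int (int m - int k) * t) - cos (of_int (int m + int k) * t)) / 2" for t
    by (simp_all add: sin_times_cos sin_times_sin left_diff_distrib distrib_right)
  show "fourier_cos (\<lambda>t. sin (real m * t)) k = 0"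
    unfolding fourier_cos_def sc
      integral_unique[OF has_integral_divide[OF has_integral_add[OF has_integral_sin_int has_integral_sin_int]]]
    by simp
  show "fourier_sin (\<lambda>t. sin (real m * t)) k = (if k = m \<and> m \<noteq> 0 then pi else 0)"
    unfolding fourier_sin_def ss
      integral_unique[OF has_integral_divide[OF has_integral_diff[OF has_integral_cos_int has_integral_cos_int]]]
    by auto
qed

lemma slit_series_single_mode:
  assumes "\<And>k. k \<noteq> m \<Longrightarrow> slit_coeff q h k = 0"
  shows "slit_series q h z = slit_coeff q h m * z ^ m"
  unfolding slit_series_def using assms by (subst suminf_finite[of "{m}"]) auto

lemma zero_complex_eq_Complex: "Complex 0 0 = 0"
  by (simp add: complex_eq_iff)

text \<open>
  By orthogonality only the mode \<open>m\<close> survives. The right-hand side also gives the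
  boundary value at \<open>r = 1\<close>, so it shows continuity up to the boundary.
\<close>

lemma slit_potential_cos:
  assumes "0 \<le> q" "q < 1" "r \<in> {q..1}"
  shows "slit_potential q (\<lambda>t. cos (real m * t)) r \<theta>
    = (r ^ m + (q\<^sup>2 / r) ^ m) / (1 + q ^ (2 * m)) * cos (real m * \<theta>)"
proof (cases "r = 1")
  case True
  have "1 + q ^ (2 * m) \<noteq> 0" using assms(1) by (smt (verit) zero_le_power)
  then show ?thesis using True by (simp add: slit_potential_def power_mult)
next
  case False
  define h where "h = (\<lambda>t. cos (real m * t))"
  note coeffs = fourier_coeffs_cos[of m, folded h_def]
  have series: "slit_series q h z = slit_coeff q h m * z ^ m" for z
    by (rule slit_series_single_mode) (simp add: slit_coeff_def coeffs zero_complex_eq_Complex)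
  have "continuous_on UNIV h" unfolding h_def by (intro continuous_intros)
  from slit_potential_eq_series[OF this assms(1,2), of r \<theta>] assms(3) False
  have "slit_potential q h r \<theta> = (Re (slit_coeff q h m * (of_real r * cis \<theta>) ^ m)
      + Re (slit_coeff q h m * (of_real (q\<^sup>2 / r) * cis (- \<theta>)) ^ m)) / pi - fourier_cos h 0 / (2 * pi)"
    unfolding slit_inversion series by simp
  also have "\<dots> = (r ^ m + (q\<^sup>2 / r) ^ m) / (1 + q ^ (2 * m)) * cos (real m * \<theta>)"
    unfolding power_mult_distrib Complex.DeMoivre of_real_power[symmetric]
    by (cases "m = 0") (simp_all add: slit_coeff_def coeffs, simp add: divide_simps, simp add: algebra_simps)
  finally show ?thesis unfolding h_def .
qed

lemma slit_potential_sin: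
  assumes "0 \<le> q" "q < 1" "r \<in> {q..1}"
  shows "slit_potential q (\<lambda>t. sin (real m * t)) r \<theta>
    = (r ^ m - (q\<^sup>2 / r) ^ m) / (1 - q ^ (2 * m)) * sin (real m * \<theta>)"
proof (cases "r = 1")
  case True
  have "1 - q ^ (2 * m) \<noteq> 0" if "m \<noteq> 0"
    using one_minus_le_one_minus_power[OF assms(1,2) that] by simp
  then show ?thesis using True by (cases "m = 0") (simp_all add: slit_potential_def power_mult)
next
  case False
  define h where "h = (\<lambda>t. sin (real m * t))"
  note coeffs = fourier_coeffs_sin[of m, folded h_def]
  have series: "slit_series q h z = slit_coeff q h m * z ^ m" for z
    by (rule slit_series_single_mode) (simp add: slit_coeff_def coeffs zero_complex_eq_Complex)
  have "continuous_on UNIV h" unfolding h_def by (intro continuous_intros)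
  from slit_potential_eq_series[OF this assms(1,2), of r \<theta>] assms(3) False
  have "slit_potential q h r \<theta> = (Re (slit_coeff q h m * (of_real r * cis \<theta>) ^ m)
      + Re (slit_coeff q h m * (of_real (q\<^sup>2 / r) * cis (- \<theta>)) ^ m)) / pi - fourier_cos h 0 / (2 * pi)"
    unfolding slit_inversion series by simp
  also have "\<dots> = (r ^ m - (q\<^sup>2 / r) ^ m) / (1 - q ^ (2 * m)) * sin (real m * \<theta>)"
    unfolding power_mult_distrib Complex.DeMoivre of_real_power[symmetric]
    by (cases "m = 0") (simp_all add: slit_coeff_def coeffs, simp add: divide_simps, simp add: algebra_simps)
  finally show ?thesis unfolding h_def .
qed

lemma slit_potential_add:
  assumes "continuous_on UNIV g" "continuous_on UNIV h" "0 \<le> q" "q < 1" "r \<in> {q..1}"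
  shows "slit_potential q (\<lambda>t. g t + h t) r \<theta> = slit_potential q g r \<theta> + slit_potential q h r \<theta>"
proof (cases "r = 1")
  case False
  then have "q \<le> r" "r < 1" using assms(5) by auto
  then have "(\<lambda>\<tau>. g \<tau> * slit_kernel q r \<theta> \<tau>) integrable_on {0..2 * pi}"
    "(\<lambda>\<tau>. h \<tau> * slit_kernel q r \<theta> \<tau>) integrable_on {0..2 * pi}"
    using slit_integral_eq_series[OF assms(1,3,4)] slit_integral_eq_series[OF assms(2-4)] by blast+
  then show ?thesis using False integral_add by (simp add: slit_potential_def distrib_right)
qed (simp add: slit_potential_def)

lemma slit_potential_scale:
  "slit_potential q (\<lambda>t. c * h t) r \<theta> = c * slit_potential q h r \<theta>"
  by (simp add: slit_potential_def mult.assoc)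

lemma slit_potential_trig_poly_continuous:
  assumes "trig_poly g" and q: "0 \<le> q" "q < 1"
  shows "continuous_on ({q..1} \<times> UNIV) (\<lambda>p. slit_potential q g (fst p) (snd p))"
  using assms(1)
proof induction
  have inv: "continuous_on ({q..1} \<times> (UNIV :: real set)) (\<lambda>p. q\<^sup>2 / fst p)"
  proof (cases "q = 0")
    case False
    then show ?thesis using q(1) by (auto intro!: continuous_intros)
  qed simp
  {
    case (cos m)
    have "continuous_on ({q..1} \<times> UNIV)
        (\<lambda>p. (fst p ^ m + (q\<^sup>2 / fst p) ^ m) * (1 / (1 + q ^ (2 * m))) * cos (real m * snd p))"
      by (intro continuous_intros inv)
    then show ?case
      by (rule continuous_on_cong[OF refl, THEN iffD1, rotated]) (auto simp: slit_potential_cos q)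
  next
    case (sin m)
    have "continuous_on ({q..1} \<times> UNIV)
        (\<lambda>p. (fst p ^ m - (q\<^sup>2 / fst p) ^ m) * (1 / (1 - q ^ (2 * m))) * sin (real m * snd p))"
      by (intro continuous_intros inv)
    then show ?case
      by (rule continuous_on_cong[OF refl, THEN iffD1, rotated]) (auto simp: slit_potential_sin q)
  next
    case (add g h)
    from continuous_on_add[OF add.IH] show ?case
      by (rule continuous_on_cong[OF refl, THEN iffD1, rotated])
        (use slit_potential_add[OF trig_poly_continuous trig_poly_continuous q] add.hyps in auto)
  next
    case (scale g c)
    then show ?case unfolding slit_potential_scale by (intro continuous_on_mult_left)
  }
qed

lemma slit_potential_trig_poly_solution:
  assumes "trig_poly g" "0 \<le> q" "q < 1"
  shows "slit_dirichlet_solution q g (slit_potential q g)"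
  using slit_potential_trig_poly_continuous[OF assms]
  by (intro slit_potential_solution_if_continuous trig_poly_continuous trig_poly_periodic assms)
    (simp add: case_prod_unfold)

lemma slit_kernel_bounded:
  assumes "0 \<le> q" "q < 1" "q \<le> r" "r < 1"
  obtains K where "\<And>\<tau>. \<bar>slit_kernel q r \<theta> \<tau>\<bar> \<le> K"
proof
  fix \<tau>
  let ?b = "\<lambda>k. (2 + 1 / (1 - q\<^sup>2)) * r ^ k"
  have "summable ?b" using assms by (intro summable_mult summable_geometric) auto
  then have "norm (\<Sum>k. slit_kernel_term q r \<theta> \<tau> k) \<le> (\<Sum>k. ?b k)"
    using slit_kernel_term_bound[OF assms(1-3)] by (intro norm_suminf_le) auto
  then show "\<bar>slit_kernel q r \<theta> \<tau>\<bar> \<le> 1 / pi * (\<Sum>k. ?b k) + 1 / (2 * pi)"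
    unfolding slit_kernel_eq[OF assms]
    by (intro order_trans[OF abs_triangle_ineq4] add_mono) (simp_all add: abs_mult divide_right_mono)
qed

text \<open>At a fixed point with \<open>r < 1\<close> the potential depends continuously on the datum in the uniform
norm. The constant \<open>K\<close> depends on \<open>r\<close>, so this alone is no uniform estimate.\<close>

lemma slit_potential_near:
  assumes g: "continuous_on UNIV g" and h: "continuous_on UNIV h" and q: "0 \<le> q" "q < 1"
    and r: "q \<le> r" "r < 1" and K: "\<And>\<tau>. \<bar>slit_kernel q r \<theta> \<tau>\<bar> \<le> K"
    and d: "\<And>t. \<bar>h t - g t\<bar> \<le> d"
  shows "\<bar>slit_potential q h r \<theta> - slit_potential q g r \<theta>\<bar> \<le> d * K * (2 * pi)"
proof -
  have pot: "((\<lambda>\<tau>. k \<tau> * slit_kernel q r \<theta> \<tau>) has_integral slit_potential q k r \<theta>) {0..2 * pi}"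
    if "continuous_on UNIV k" for k
    unfolding slit_potential_eq_series[OF that q r] by (rule slit_integral_eq_series[OF that q r])
  have "((\<lambda>\<tau>. (h \<tau> - g \<tau>) * slit_kernel q r \<theta> \<tau>) has_integral
      slit_potential q h r \<theta> - slit_potential q g r \<theta>) {0..2 * pi}"
    using has_integral_diff[OF pot[OF h] pot[OF g]] by (simp add: left_diff_distrib)
  moreover have "0 \<le> d" "0 \<le> K" using d[of 0] K[of 0] by linarith+
  moreover have "norm ((h \<tau> - g \<tau>) * slit_kernel q r \<theta> \<tau>) \<le> d * K" for \<tau>
    unfolding real_norm_def abs_mult using d K \<open>0 \<le> d\<close> by (intro mult_mono) auto
  ultimately show ?thesis
    using has_integral_bound_real[OF _ finite.emptyI, of "d * K" "\<lambda>\<tau>. (h \<tau> - g \<tau>) * slit_kernel q r \<theta> \<tau>"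
        "slit_potential q h r \<theta> - slit_potential q g r \<theta>" 0 "2 * pi"] by simp
qed

text \<open>Compare \<open>g\<close> with a second trigonometric polynomial much closer to \<open>h\<close>: the maximum principle
bounds the difference of the two potentials independently of \<open>r\<close>, while at the given point the
potential of the second is as close to that of \<open>h\<close> as desired.\<close>

lemma slit_potential_trig_poly_approx:
  assumes h: "continuous_on UNIV h" and per: "\<And>\<theta>. h (\<theta> + 2 * pi) = h \<theta>" and q: "0 \<le> q" "q < 1"
    and g: "trig_poly g" "\<And>t. \<bar>h t - g t\<bar> \<le> e" and r: "r \<in> {q..1}"
  shows "\<bar>slit_potential q h r \<theta> - slit_potential q g r \<theta>\<bar> \<le> e"
proof (cases "r = 1")
  case True
  then show ?thesis using g(2) by (simp add: slit_potential_def)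
next
  case False
  then have r': "q \<le> r" "r < 1" using r by auto
  obtain K where K: "\<And>\<tau>. \<bar>slit_kernel q r \<theta> \<tau>\<bar> \<le> K"
    using slit_kernel_bounded[OF q r'] by blast
  then have "K \<ge> 0" by (meson abs_ge_zero order_trans)
  show ?thesis
  proof (rule field_le_epsilon)
    fix \<delta> :: real assume "\<delta> > 0"
    \<comment> \<open>Chosen so that the error \<open>2 \<pi> K d\<close> of the potential and the error \<open>d\<close> of the datum
      add up to \<open>\<delta>\<close>.\<close>
    define d where "d = \<delta> / (K * (2 * pi) + 1)"
    have pos: "K * (2 * pi) + 1 > 0" using \<open>K \<ge> 0\<close> by (simp add: add_nonneg_pos)
    then have "d > 0" "d * (K * (2 * pi) + 1) = \<delta>"
      using \<open>\<delta> > 0\<close> by (simp_all add: d_def)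
    then have d: "d > 0" "d * K * (2 * pi) + d = \<delta>"
      by (simp_all add: distrib_left mult.assoc)
    obtain k where k: "trig_poly k" "\<And>t. \<bar>h t - k t\<bar> < d"
      using trig_poly_dense[OF h per \<open>d > 0\<close>] by blast
    have "\<bar>k t - g t\<bar> \<le> e + d" for t using g(2)[of t] k(2)[of t] by linarith
    then have "\<bar>slit_potential q k r \<theta> - slit_potential q g r \<theta>\<bar> \<le> e + d"
      by (rule slit_dirichlet_solution_abs_diff_le[OF slit_potential_trig_poly_solution[OF k(1) q]
            slit_potential_trig_poly_solution[OF g(1) q] q _ r])
    moreover have "\<bar>slit_potential q h r \<theta> - slit_potential q k r \<theta>\<bar> \<le> d * K * (2 * pi)"
      using slit_potential_near[OF trig_poly_continuous[OF k(1)] h q r' K] k(2) by (simp add: less_imp_le)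
    ultimately show "\<bar>slit_potential q h r \<theta> - slit_potential q g r \<theta>\<bar> \<le> e + \<delta>"
      using d(2) by linarith
  qed
qed

lemma slit_potential_is_solution:
  assumes h: "continuous_on UNIV h" and per: "\<And>\<theta>. h (\<theta> + 2 * pi) = h \<theta>" and q: "0 \<le> q" "q < 1"
  shows "slit_dirichlet_solution q h (slit_potential q h)"
proof (rule slit_potential_solution_if_continuous[OF h per q])
  have "\<exists>g. trig_poly g \<and> (\<forall>t. \<bar>h t - g t\<bar> < inverse (real (Suc n)))" for n
    by (rule trig_poly_dense[OF h per, of "inverse (real (Suc n))"]) auto
  then obtain g where g: "\<And>n. trig_poly (g n)" "\<And>n t. \<bar>h t - g n t\<bar> < inverse (real (Suc n))"
    by metis
  have "uniform_limit ({q..1} \<times> UNIV) (\<lambda>n p. slit_potential q (g n) (fst p) (snd p))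
      (\<lambda>p. slit_potential q h (fst p) (snd p)) sequentially"
  proof (rule uniform_limitI)
    fix e :: real assume "e > 0"
    have "\<forall>\<^sub>F n in sequentially. inverse (real (Suc n)) < e"
      using LIMSEQ_inverse_real_of_nat \<open>e > 0\<close> by (rule order_tendstoD)
    then show "\<forall>\<^sub>F n in sequentially. \<forall>p\<in>{q..1} \<times> UNIV.
        dist (slit_potential q (g n) (fst p) (snd p)) (slit_potential q h (fst p) (snd p)) < e"
    proof eventually_elim
      case (elim n)
      have "\<bar>slit_potential q h r \<theta> - slit_potential q (g n) r \<theta>\<bar> < e" if "r \<in> {q..1}" for r \<theta>
        using slit_potential_trig_poly_approx[OF h per q g(1) less_imp_le[OF g(2)] that] elim
        by (rule le_less_trans)
      then show ?case by (auto simp: dist_real_def abs_minus_commute)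
    qed
  qed
  then show "continuous_on ({q..1} \<times> UNIV) (\<lambda>(r, \<theta>). slit_potential q h r \<theta>)"
    unfolding case_prod_unfold
    by (rule uniform_limit_theorem[rotated])
      (auto intro!: always_eventually slit_potential_trig_poly_continuous g q)
qed

section \<open>Existence and uniqueness\<close>

lemma slit_solution_cong:
  assumes "slit_dirichlet_solution q h f" "q < 1" "\<And>r \<theta>. r \<in> {q..1} \<Longrightarrow> g r \<theta> = f r \<theta>"
  shows "slit_dirichlet_solution q h g"
proof -
  obtain fr frr ft ftt where "slit_solution q h f fr frr ft ftt"
    using assms(1) unfolding slit_dirichlet_solution_iff by blast
  then interpret slit_solution q h f fr frr ft ftt .
  have "slit_solution q h g fr frr ft ftt"
  proof
    show "continuous_on ({q..1} \<times> UNIV) (\<lambda>(r, \<theta>). g r \<theta>)"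
      by (rule continuous_on_cong[THEN iffD2, OF refl _ cont]) (auto simp: assms(3))
    fix r \<theta> :: real assume r: "r \<in> {q..<1}" "0 < r"
    show "((\<lambda>s. g s \<theta>) has_real_derivative fr r \<theta>) (at r within {q..1})"
      by (rule has_field_derivative_transform_within[OF fr[OF r], where d = 1]) (use r assms(3) in auto)
    show "((\<lambda>t. g r t) has_real_derivative ft r \<theta>) (at \<theta>)"
      using ft[OF r] r by (simp add: assms(3))
    show "((\<lambda>s. fr s \<theta>) has_real_derivative frr r \<theta>) (at r within {q..1})" by (rule frr[OF r])
    show "((\<lambda>t. ft r t) has_real_derivative ftt r \<theta>) (at \<theta>)" by (rule ftt[OF r])
    show "frr r \<theta> + 1 / r * fr r \<theta> + 1 / r\<^sup>2 * ftt r \<theta> = 0" by (rule laplace[OF r])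
  next
    fix \<theta> :: real
    show "fr q \<theta> = - fr q (- \<theta>)" if "0 < q" by (rule slope_odd[OF that])
    have "g q t = f q t" "g 1 t = f 1 t" for t using assms(2,3) by simp_all
    then show "g 1 \<theta> = h \<theta>" "g q \<theta> = g q (- \<theta>)"
      using boundary[of \<theta>] value_even[of \<theta>] by (simp_all only:)
  qed (simp add: assms(3) periodic)
  then show ?thesis unfolding slit_dirichlet_solution_iff by blast
qed

lemma slit_dirichlet_solution_iff_potential:
  assumes h: "continuous_on UNIV h" and per: "\<And>\<theta>. h (\<theta> + 2 * pi) = h \<theta>" and q: "0 \<le> q" "q < 1"
  shows "slit_dirichlet_solution q h f \<longleftrightarrow> (\<forall>r\<in>{q..1}. \<forall>\<theta>. f r \<theta> = slit_potential q h r \<theta>)"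
proof
  assume "slit_dirichlet_solution q h f"
  then show "\<forall>r\<in>{q..1}. \<forall>\<theta>. f r \<theta> = slit_potential q h r \<theta>"
    using slit_dirichlet_solution_abs_diff_le[OF _ slit_potential_is_solution[OF h per q] q, where M = 0]
    by fastforce
next
  assume "\<forall>r\<in>{q..1}. \<forall>\<theta>. f r \<theta> = slit_potential q h r \<theta>"
  then show "slit_dirichlet_solution q h f"
    using slit_solution_cong[OF slit_potential_is_solution[OF h per q] q(2)] by blast
qed

lemma focal_radius_bounds:
  fixes R \<rho> a b q :: real
  assumes "R > 0" and "\<bar>\<rho>\<bar> < 1"
    and "a = R / sqrt (1 - \<bar>\<rho>\<bar>)" and "b = R / sqrt (1 + \<bar>\<rho>\<bar>)" and "q = sqrt ((a - b) / (a + b))"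
  shows "0 \<le> q" "q < 1"
proof -
  have "b > 0" "b \<le> a" using assms by (auto intro!: divide_left_mono)
  then show "0 \<le> q" "q < 1" unfolding assms(5) by (auto simp: divide_less_eq)
qed

theorem theorem2:
  fixes R \<rho> a b q :: real and h :: "real \<Rightarrow> real"
  assumes "R > 0" and "\<bar>\<rho>\<bar> < 1"
    and "a = R / sqrt (1 - \<bar>\<rho>\<bar>)" and "b = R / sqrt (1 + \<bar>\<rho>\<bar>)"
    and "q = sqrt ((a - b) / (a + b))"
    and "continuous_on UNIV h" and "\<And>\<theta>. h (\<theta> + 2 * pi) = h \<theta>"
  shows "(\<forall>r\<in>{q..<1}. \<forall>\<theta>.
            (\<forall>\<tau>. summable (\<lambda>k. slit_kernel_term q r \<theta> \<tau> (Suc k))) \<and>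
            (\<lambda>\<tau>. h \<tau> * slit_kernel q r \<theta> \<tau>) integrable_on {0..2 * pi}) \<and>
         (\<forall>f. slit_dirichlet_solution q h f \<longleftrightarrow>
            (\<forall>\<theta>. f 1 \<theta> = h \<theta> \<and>
               (\<forall>r\<in>{q..<1}.
                  f r \<theta> = integral {0..2 * pi} (\<lambda>\<tau>. h \<tau> * slit_kernel q r \<theta> \<tau>))))"
proof (intro conjI allI ballI)
  note q = focal_radius_bounds[OF assms(1-5)]
  show "summable (\<lambda>k. slit_kernel_term q r \<theta> \<tau> (Suc k))"
    and "(\<lambda>\<tau>. h \<tau> * slit_kernel q r \<theta> \<tau>) integrable_on {0..2 * pi}"
    if "r \<in> {q..<1}" for r \<theta> \<tau>
    using that slit_integral_eq_series[OF assms(6) q, of r \<theta>] summable_slit_kernel_term[OF q, of r \<theta> \<tau>]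
    by (auto simp: summable_Suc_iff)
  have "{q..1} = insert 1 {q..<1}" using q by auto
  then show "slit_dirichlet_solution q h f \<longleftrightarrow>
            (\<forall>\<theta>. f 1 \<theta> = h \<theta> \<and>
               (\<forall>r\<in>{q..<1}.
                  f r \<theta> = integral {0..2 * pi} (\<lambda>\<tau>. h \<tau> * slit_kernel q r \<theta> \<tau>)))" for f
    unfolding slit_dirichlet_solution_iff_potential[OF assms(6,7) q]
    by (auto simp: slit_potential_def)
qed

end
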